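(* The rings meet the spherical layers of $\mathcal{T}_{120}$ as follows. Every cell-centre $p \in \mathcal{D}^*$ lies at one of the nine spherical distances from $1$ listed below. For each such distance, the table gives: the type of the rotation $\psi_p \in \mathcal{D}$ for $p$ in that layer; the number of cells in the layer; the number of these cells in the spinal ring $R$; the number in the equatorial ring $R^{\mathrm{eq}}$; the number remaining after the spinal and equatorial rings are removed; the number in each single inner ring $R^{\mathrm{in}}_i$ ($0 \le i \le 4$); and the number in each single outer ring $R^{\mathrm{out}}_i$ ($0 \le i \le 4$). $$ \begin{array}{clcccccc} \text{distance} & \text{rotation type} & \#\text{ cells} & \text{spinal} & \text{equatorial} & \text{remaining} & \text{inner} & \text{outer} \\ 0 & \text{identity} & 1 & 1 & 0 & 0 & 0 & 0 \\ \pi/5 & \text{face} & 12 & 2 & 0 & 10 & 2 & 0 \\ \pi/3 & \text{vertex} & 20 & 0 & 0 & 20 & 2 & 2 \\ 2\pi/5 & \text{face} & 12 & 2 & 0 & 10 & 0 & 2 \\ \pi/2 & \text{edge} & 30 & 0 & 10 & 20 & 2 & 2 \\ 3\pi/5 & \text{face} & 12 & 2 & 0 & 10 & 0 & 2 \\ 2\pi/3 & \text{vertex} & 20 & 0 & 0 & 20 & 2 & 2 \\ 4\pi/5 & \text{face} & 12 & 2 & 0 & 10 & 2 & 0 \\ \pi & \text{identity} & 1 & 1 & 0 & 0 & 0 & 0 \end{array} $$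
   Context: Let $\mathbb{H} = \mathbb{R} \oplus \mathbb{I}$ be the quaternions, identified with $\mathbb{R}^4$ with orthonormal basis $1, i, j, k$, where $\mathbb{I} = i\mathbb{R} \oplus j\mathbb{R} \oplus k\mathbb{R} \cong \mathbb{R}^3$ is the subspace of purely imaginary quaternions. Let $S^3 = \{q \in \mathbb{H} : |q| = 1\}$ be the group of unit quaternions, with metric $d_S(p,q) = \arccos \langle p, q\rangle$. The point $1$ is called the south pole. For $q \in S^3$ let $\psi_q \in \mathrm{SO}(3) = \mathrm{Isom}^+_0(\mathbb{I})$ (the orientation-preserving isometries of $\mathbb{I}$ fixing the origin) be $\psi_q(p) = q p q^{-1}$; the map $\psi : S^3 \to \mathrm{SO}(3)$, $q \mapsto \psi_q$, is a two-to-one homomorphism. Set $x = \frac{1}{2}(\cot \frac{\pi}{5} + \cot \frac{2\pi}{5})$ and $y = \frac{1}{2}(\cot \frac{\pi}{5} - \cot \frac{2\pi}{5})$, so $x^2 + y^2 = 1$. Let $D \subset \mathbb{I}$ be the regular dodecahedron with vertices on the unit sphere of $\mathbb{I}$, positioned so that its twelve face centres lie in the directions $\pm x i \pm y j$, $\pm x j \pm y k$, $\pm y i \pm x k$ (all sign choices); it has a vertex at $\frac{1}{\sqrt 3}(i+j+k)$. Let $\mathcal{D} \subset \mathrm{SO}(3)$ be the group (of order 60) of orientation-preserving symmetries of $D$, and let $\mathcal{D}^* = \psi^{-1}(\mathcal{D}) \subset S^3$ be the binary dodecahedral group (of order 120). A non-identity element of $\mathcal{D}$ is a face, vertex, or edge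 rotation according to whether its axis passes through a face centre, a vertex, or an edge midpoint of $D$. The tiling $\mathcal{T}_{120}$ of $S^3$ has three-cells $\mathrm{Vor}(q) = \{ r \in S^3 : d_S(q,r) \le d_S(p,r) \text{ for all } p \in \mathcal{D}^*\}$, $q \in \mathcal{D}^*$; the cell-centres are the elements of $\mathcal{D}^*$, and cells are identified with their centres. A layer is the set of all cells whose centres lie at a given spherical distance from $1$. Let $f = x i + y j$ and $f' = x j + y k$ (unit vectors towards the centres of two adjacent faces of $D$), and let $q = \cos\frac{\pi}{5} + f \sin\frac{\pi}{5}$ and $q' = \cos\frac{\pi}{5} + f' \sin\frac{\pi}{5}$, both in $\mathcal{D}^*$. Let $R = \langle q \rangle < \mathcal{D}^*$, a cyclic group of order ten. The rings are the twelve right cosets $R \cdot p$ of $R$ in $\mathcal{D}^*$: the spinal ring is $R$ itself; the equatorial ring $R^{\mathrm{eq}}$ is the coset all of whose elements are at distance $\pi/2$ from $1$; the inner rings are the five cosets $R^{\mathrm{in}}_i = R \cdot q' q^{-i}$, $i = 0,1,2,3,4$; the outer rings $R^{\mathrm{out}}_0, \dots, R^{\mathrm{out}}_4$ are the remaining five cosets. *)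

theory Defs
  imports "HOL-Analysis.Analysis" "HOL-Algebra.Coset" "HOL-Algebra.Generated_Groups"
begin

(* The pair (a, u) stands for the quaternion a + u1 i + u2 j + u3 k.  The product-space inner
   product and norm are then those of R^4 with 1, i, j, k orthonormal, and the purely
   imaginary quaternions (0, u) are identified with u in R^3. *)
type_synonym quat = "real \<times> (real ^ 3)"

definition qone :: quat where
  "qone = (1, 0)"

definition qmult :: "quat \<Rightarrow> quat \<Rightarrow> quat" where
  "qmult p q = (fst p * fst q - snd p \<bullet> snd q,
                fst p *\<^sub>R snd q + fst q *\<^sub>R snd p + cross3 (snd p) (snd q))"

definition qinverse :: "quat \<Rightarrow> quat" where
  "qinverse q = (1 / (norm q)\<^sup>2) *\<^sub>R (fst q, - snd q)"

definition S3 :: "quat set" where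
  "S3 = sphere 0 1"

definition dist_S :: "quat \<Rightarrow> quat \<Rightarrow> real" where
  "dist_S p q = arccos (p \<bullet> q)"

(* The product under snd is purely imaginary, so snd is the identification with R^3. *)
definition psi :: "quat \<Rightarrow> real ^ 3 \<Rightarrow> real ^ 3" where
  "psi q v = snd (qmult (qmult q (0, v)) (qinverse q))"

definition SO3 :: "(real ^ 3 \<Rightarrow> real ^ 3) set" where
  "SO3 = {g. orthogonal_transformation g \<and> det (matrix g) = 1}"

definition dod_x :: real where
  "dod_x = (cot (pi / 5) + cot (2 * pi / 5)) / 2"

definition dod_y :: real where
  "dod_y = (cot (pi / 5) - cot (2 * pi / 5)) / 2"

definition face_directions :: "(real ^ 3) set" where
  "face_directions =
     {vector [s * dod_x, t * dod_y, 0] | s t. s \<in> {- 1, 1} \<and> t \<in> {- 1, 1}} \<union>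
     {vector [0, s * dod_x, t * dod_y] | s t. s \<in> {- 1, 1} \<and> t \<in> {- 1, 1}} \<union>
     {vector [s * dod_y, 0, t * dod_x] | s t. s \<in> {- 1, 1} \<and> t \<in> {- 1, 1}}"

(* The face directions are unit vectors, so (x + y) / sqrt 3 is the distance of the face planes
   from the origin.  It is the inner product of the vertex (i + j + k) / sqrt 3 with the normals
   of the three faces meeting there, which puts the vertices on the unit sphere. *)
definition dodecahedron :: "(real ^ 3) set" where
  "dodecahedron = {v. \<forall>n \<in> face_directions. n \<bullet> v \<le> (dod_x + dod_y) / sqrt 3}"

definition dod_group :: "(real ^ 3 \<Rightarrow> real ^ 3) set" where
  "dod_group = {g \<in> SO3. g ` dodecahedron = dodecahedron}"

definition bin_dod :: "quat set" where
  "bin_dod = {q \<in> S3. psi q \<in> dod_group}"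

definition bin_dod_group :: "quat monoid" where
  "bin_dod_group = \<lparr>carrier = bin_dod, monoid.mult = qmult, one = qone\<rparr>"

definition dod_vertices :: "(real ^ 3) set" where
  "dod_vertices = {v. v extreme_point_of dodecahedron}"

definition centroid :: "(real ^ 3) set \<Rightarrow> real ^ 3" where
  "centroid P = (1 / real (card {v. v extreme_point_of P})) *\<^sub>R \<Sum>{v. v extreme_point_of P}"

definition dod_face_centres :: "(real ^ 3) set" where
  "dod_face_centres = {centroid F | F. F facet_of dodecahedron}"

definition dod_edge_midpoints :: "(real ^ 3) set" where
  "dod_edge_midpoints = {midpoint a b | a b. closed_segment a b edge_of dodecahedron}"

datatype rotation_type = Identity | Face | Vertex | Edge

(* The axis of g is its set of fixed points, a line through the origin if g is a
   non-identity rotation. *)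
fun has_rotation_type :: "(real ^ 3 \<Rightarrow> real ^ 3) \<Rightarrow> rotation_type \<Rightarrow> bool" where
  "has_rotation_type g Identity \<longleftrightarrow> g = id"
| "has_rotation_type g Face \<longleftrightarrow> g \<noteq> id \<and> {v. g v = v} \<inter> dod_face_centres \<noteq> {}"
| "has_rotation_type g Vertex \<longleftrightarrow> g \<noteq> id \<and> {v. g v = v} \<inter> dod_vertices \<noteq> {}"
| "has_rotation_type g Edge \<longleftrightarrow> g \<noteq> id \<and> {v. g v = v} \<inter> dod_edge_midpoints \<noteq> {}"

definition Vor :: "quat \<Rightarrow> quat set" where
  "Vor q = {r \<in> S3. \<forall>p \<in> bin_dod. dist_S q r \<le> dist_S p r}"

definition layer :: "real \<Rightarrow> quat set set" where
  "layer d = {Vor p | p. p \<in> bin_dod \<and> dist_S qone p = d}"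

definition gen_q :: quat where
  "gen_q = (cos (pi / 5), sin (pi / 5) *\<^sub>R vector [dod_x, dod_y, 0])"

definition gen_q' :: quat where
  "gen_q' = (cos (pi / 5), sin (pi / 5) *\<^sub>R vector [0, dod_x, dod_y])"

(* Rings are sets of cell-centres; Vor ` C is the set of cells belonging to the ring C. *)
definition spinal_ring :: "quat set" where
  "spinal_ring = generate bin_dod_group {gen_q}"

definition rings :: "quat set set" where
  "rings = rcosets\<^bsub>bin_dod_group\<^esub> spinal_ring"

definition equatorial_ring :: "quat set" where
  "equatorial_ring = (THE C. C \<in> rings \<and> (\<forall>p \<in> C. dist_S qone p = pi / 2))"

definition inner_ring :: "nat \<Rightarrow> quat set" where
  "inner_ring i = spinal_ring #>\<^bsub>bin_dod_group\<^esub>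
     (gen_q' \<otimes>\<^bsub>bin_dod_group\<^esub> (gen_q [^]\<^bsub>bin_dod_group\<^esub> (- int i)))"

definition outer_rings :: "quat set set" where
  "outer_rings = rings - {spinal_ring, equatorial_ring} - inner_ring ` {0..4}"

(* One row of the table; the type of the rotations in the layer is exactly T and no other. *)
definition layer_row ::
  "real \<Rightarrow> rotation_type \<Rightarrow> nat \<Rightarrow> nat \<Rightarrow> nat \<Rightarrow> nat \<Rightarrow> nat \<Rightarrow> nat \<Rightarrow> bool" where
  "layer_row d T n_cells n_spinal n_equatorial n_remaining n_inner n_outer \<longleftrightarrow>
     (\<forall>p \<in> bin_dod. dist_S qone p = d \<longrightarrow> (\<forall>T'. has_rotation_type (psi p) T' \<longleftrightarrow> T' = T)) \<and>
     card (layer d) = n_cells \<and>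
     card (layer d \<inter> Vor ` spinal_ring) = n_spinal \<and>
     card (layer d \<inter> Vor ` equatorial_ring) = n_equatorial \<and>
     card (layer d - Vor ` spinal_ring - Vor ` equatorial_ring) = n_remaining \<and>
     (\<forall>i \<in> {0..4}. card (layer d \<inter> Vor ` inner_ring i) = n_inner) \<and>
     (\<forall>C \<in> outer_rings. card (layer d \<inter> Vor ` C) = n_outer)"

end

theory Submission
  imports Defs
begin

text \<open>The rows of the table are counts in an explicit list of the 120 elements of the binary
  dodecahedral group, together with a geometric determination of the rotation types.

  A rotation preserves the dodecahedron exactly when it permutes the twelve face directions
  (\<open>orthogonal_image_dodecahedron_iff\<close>), so membership in the group is a finite condition. All
  elements of the group are half of quaternions with coordinates in \<open>\<int>[\<phi>]\<close>, where \<open>\<phi>\<close> is the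
  golden ratio, and products of such quaternions are computed with pairs of integers. Products
  of \<open>q\<close>, \<open>q'\<close> and \<open>k\<close> give twelve right cosets of the spinal ring, with ten elements each.
  Conversely, an element of the group is determined up to sign by the images of two adjacent
  face directions, for which there are 60 possibilities; hence the group has at most 120
  elements and is the list found (\<open>bin_dod_eq\<close>). The distance of \<open>p\<close> from \<open>1\<close> is the arc cosine
  of its real part, and Voronoi cells with different centres are different, so the cells in a
  layer and in a ring are counted by the elements with a given real part in the list of the ring
  (\<open>layer_row_counts\<close>).

  For the types, every layer is a conjugacy class of the group, and the type of a rotation is
  invariant under conjugation by symmetries of the dodecahedron. So one representative of each
  layer is enough, and its axis passes through an explicit face centre, vertex or edge midpoint
  (\<open>face_centre\<close>, \<open>vertex_111\<close>, \<open>edge_midpoint_100\<close>). That no rotation has two types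
  (\<open>rotation_type_unique\<close>) follows from the fact that face centres, edge midpoints and vertices
  lie in the relative interiors of faces of dimension 2, 1 and 0, and that an axis meets the
  boundary of the dodecahedron in two opposite points only.\<close>

section \<open>The golden ratio\<close>

definition golden :: real where
  "golden = (1 + sqrt 5) / 2"

lemma golden_square: "golden * golden = golden + 1"
  by (simp add: golden_def field_simps)

lemma golden_gt_1: "golden > 1"
proof -
  have "sqrt 5 > 1" by simp
  then show ?thesis by (simp add: golden_def)
qed

lemma cos_pi_fifth: "cos (pi / 5) = golden / 2"
proof -
  define c where "c = cos (pi / 5)"
  have "c > 0" unfolding c_def by (rule cos_gt_zero) auto
  have "cos (3 * (pi / 5)) = - cos (2 * (pi / 5))"
  proof -
    have "3 * (pi / 5) = pi - 2 * (pi / 5)" by simp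
    then show ?thesis by (metis cos_pi_minus)
  qed
  then have "4 * c ^ 3 - 3 * c = - (2 * c\<^sup>2 - 1)"
    by (simp only: c_def cos_treble_cos cos_double_cos)
  \<comment> \<open>the factor \<open>c + 1\<close> belongs to the solution \<open>x = \<pi>\<close> of \<open>cos 3x = - cos 2x\<close>\<close>
  then have "(c + 1) * (4 * c\<^sup>2 - 2 * c - 1) = 0"
    by (simp add: algebra_simps power2_eq_square power3_eq_cube)
  then have "4 * c\<^sup>2 - 2 * c - 1 = 0" using \<open>c > 0\<close> by simp
  then have "(4 * c - 1)\<^sup>2 = 5" by (simp add: power2_eq_square algebra_simps)
  then have "\<bar>4 * c - 1\<bar> = sqrt 5" by (metis real_sqrt_abs)
  moreover have "sqrt 5 > 1" by simp
  ultimately have "4 * c - 1 = sqrt 5" using \<open>c > 0\<close> by linarith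
  then show ?thesis by (simp add: golden_def c_def)
qed

lemma cos_two_pi_fifth: "cos (2 * pi / 5) = (golden - 1) / 2"
  using cos_double_cos[of "pi / 5"] golden_square
  by (simp add: cos_pi_fifth power2_eq_square algebra_simps)

lemma sin_pi_fifth_pos: "sin (pi / 5) > 0" "sin (2 * pi / 5) > 0"
  by (auto intro!: sin_gt_zero)

lemma dod_x_eq: "dod_x = 1 / (2 * sin (pi / 5))"
proof -
  define s S c C where d: "s = sin (pi / 5)" "S = sin (2 * pi / 5)"
    "c = cos (pi / 5)" "C = cos (2 * pi / 5)"
  have "pi - 2 * pi / 5 = pi / 5 + 2 * pi / 5" by simp
  then have "S = s * C + c * S" unfolding d by (metis sin_pi_minus sin_add)
  moreover have "c / s + C / S = (s * C + c * S) / (s * S)"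
    using sin_pi_fifth_pos by (simp add: d add_frac_eq algebra_simps)
  moreover have "s > 0" "S > 0" using sin_pi_fifth_pos by (auto simp: d)
  ultimately have "c / s + C / S = 1 / s" by simp
  then show ?thesis by (simp add: dod_x_def cot_def d)
qed

lemma dod_y_eq: "dod_y = 1 / (2 * sin (2 * pi / 5))"
proof -
  define s S c C where d: "s = sin (pi / 5)" "S = sin (2 * pi / 5)"
    "c = cos (pi / 5)" "C = cos (2 * pi / 5)"
  have "2 * pi / 5 - pi / 5 = pi / 5" by simp
  then have "s = S * c - C * s" unfolding d by (metis sin_diff)
  moreover have "c / s - C / S = (S * c - C * s) / (s * S)"
    using sin_pi_fifth_pos by (simp add: d diff_frac_eq algebra_simps)
  moreover have "s > 0" "S > 0" using sin_pi_fifth_pos by (auto simp: d)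
  ultimately have "c / s - C / S = 1 / S" by simp
  then show ?thesis by (simp add: dod_y_def cot_def d)
qed

lemma dod_x_eq_golden: "dod_x = golden * dod_y"
  using sin_double[of "pi / 5"] sin_pi_fifth_pos golden_gt_1
  by (simp add: dod_x_eq dod_y_eq cos_pi_fifth field_simps)

lemma dod_y_pos: "dod_y > 0"
  using sin_pi_fifth_pos by (simp add: dod_y_eq)

lemma sin_dod_x: "sin (pi / 5) * dod_x = 1 / 2"
  using sin_pi_fifth_pos by (simp add: dod_x_eq)

lemma sin_dod_y: "sin (pi / 5) * dod_y = (golden - 1) / 2"
proof -
  have "golden * (sin (pi / 5) * dod_y) = 1 / 2"
    using sin_dod_x by (simp add: dod_x_eq_golden algebra_simps)
  also have "\<dots> = golden * ((golden - 1) / 2)"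
    using golden_square by (simp add: algebra_simps)
  finally show ?thesis using golden_gt_1 by simp
qed

text \<open>This is the normalisation \<open>x\<^sup>2 + y\<^sup>2 = 1\<close>, written in terms of \<open>y\<close> by means of \<open>x = \<phi> y\<close>
  and \<open>\<phi>\<^sup>2 = \<phi> + 1\<close>.\<close>

lemma dod_y_square: "dod_y * dod_y * (golden + 2) = 1"
proof -
  have s: "(sin (pi / 5))\<^sup>2 = 1 - (golden / 2)\<^sup>2"
    using sin_cos_squared_add[of "pi / 5"] by (simp add: cos_pi_fifth)
  have "(sin (pi / 5))\<^sup>2 * (dod_y * dod_y * (golden + 2)) = (sin (pi / 5) * dod_y)\<^sup>2 * (golden + 2)"
    by (simp add: power2_eq_square)
  also have "\<dots> = (sin (pi / 5))\<^sup>2"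
  proof -
    have "(golden - 1) * (golden - 1) * (golden + 2) = 4 - golden * golden"
      using golden_square by algebra
    then show ?thesis unfolding sin_dod_y s by (simp add: power2_eq_square field_simps)
  qed
  finally show ?thesis using sin_pi_fifth_pos by simp
qed

text \<open>Irrationality of \<open>\<surd>5\<close>, by descent, and hence uniqueness of the representation \<open>a + b \<phi>\<close>
  with integers \<open>a\<close> and \<open>b\<close>.\<close>

lemma square_eq_5_times_square:
  fixes m n :: nat
  assumes "m * m = 5 * (n * n)"
  shows "n = 0"
  using assms
proof (induction n arbitrary: m rule: less_induct)
  case (less n)
  have p5: "prime (5::nat)" by simp
  have "5 dvd m * m" using less.prems by simp
  then have "5 dvd m" using p5 prime_dvd_multD by blast
  then obtain k where k: "m = 5 * k" by blast
  have n: "n * n = 5 * (k * k)" using less.prems k by simp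
  show ?case
  proof (rule ccontr)
    assume "n \<noteq> 0"
    have "k < n"
    proof (rule ccontr)
      assume "\<not> k < n"
      then have "n * n \<le> k * k" by (simp add: mult_le_mono)
      with n \<open>n \<noteq> 0\<close> show False by simp
    qed
    from less.IH[OF this n] n \<open>n \<noteq> 0\<close> show False by simp
  qed
qed

lemma int_golden_eq_0:
  fixes a b :: int
  assumes "of_int a + of_int b * golden = 0"
  shows "a = 0 \<and> b = 0"
proof -
  have "of_int (2 * a + b) = - of_int b * sqrt 5"
    using assms by (simp add: golden_def field_simps)
  then have "(of_int (2 * a + b))\<^sup>2 = (of_int b)\<^sup>2 * (5::real)"
    by (simp add: power_mult_distrib)
  then have "of_int ((2 * a + b)\<^sup>2) = (of_int (b\<^sup>2 * 5) :: real)" by simp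
  then have "(2 * a + b)\<^sup>2 = b\<^sup>2 * 5" by (simp only: of_int_eq_iff)
  then have "nat \<bar>2 * a + b\<bar> * nat \<bar>2 * a + b\<bar> = 5 * (nat \<bar>b\<bar> * nat \<bar>b\<bar>)"
    by (simp add: nat_mult_distrib[symmetric] abs_mult_self_eq power2_eq_square
        flip: abs_mult)
  then have "b = 0" using square_eq_5_times_square by fastforce
  then show ?thesis using assms by simp
qed

section \<open>Unit quaternions and rotations\<close>

lemmas quat_simps = qmult_def prod_eq_iff vec_eq_iff forall_3 cross3_def inner_vec_def sum_3

lemma qmult_assoc: "qmult (qmult p q) r = qmult p (qmult q r)"
  by (simp add: quat_simps algebra_simps)

lemma qmult_one [simp]: "qmult qone q = q" "qmult q qone = q"
  by (simp_all add: quat_simps qone_def)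

text \<open>Quaternion conjugation; on \<open>S3\<close> it is the inverse.\<close>

definition qcnj :: "quat \<Rightarrow> quat" where
  "qcnj q = (fst q, - snd q)"

lemma S3_iff: "q \<in> S3 \<longleftrightarrow> fst q * fst q + snd q \<bullet> snd q = 1"
proof -
  have "q \<in> S3 \<longleftrightarrow> q \<bullet> q = 1" by (simp add: S3_def norm_eq_1)
  then show ?thesis by (simp add: inner_prod_def)
qed

lemma qone_S3: "qone \<in> S3"
  by (simp add: S3_iff qone_def)

lemma qcnj_S3: "q \<in> S3 \<Longrightarrow> qcnj q \<in> S3"
  by (simp add: S3_iff qcnj_def)

lemma qmult_S3:
  assumes "p \<in> S3" "q \<in> S3"
  shows "qmult p q \<in> S3"
proof -
  have "fst (qmult p q) * fst (qmult p q) + snd (qmult p q) \<bullet> snd (qmult p q) =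
      (fst p * fst p + snd p \<bullet> snd p) * (fst q * fst q + snd q \<bullet> snd q)"
    by (simp add: quat_simps) algebra
  then show ?thesis using assms by (simp add: S3_iff)
qed

lemma qinverse_S3: "q \<in> S3 \<Longrightarrow> qinverse q = qcnj q"
  by (simp add: qinverse_def qcnj_def S3_def)

lemma qmult_qcnj:
  assumes "q \<in> S3"
  shows "qmult q (qcnj q) = qone" "qmult (qcnj q) q = qone"
  using assms by (simp_all add: S3_iff quat_simps qcnj_def qone_def)

lemma qmult_uminus_right: "qmult p (- q) = - qmult p q"
  by (simp add: quat_simps)

lemma psi_quat:
  assumes "q \<in> S3"
  shows "(0, psi q v) = qmult (qmult q (0, v)) (qcnj q)"
  unfolding psi_def qinverse_S3[OF assms]
  by (simp add: quat_simps qcnj_def) algebra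

lemma psi_mult:
  assumes "p \<in> S3" "q \<in> S3"
  shows "psi (qmult p q) v = psi p (psi q v)"
proof -
  have c: "qcnj (qmult p q) = qmult (qcnj q) (qcnj p)"
    by (simp add: quat_simps qcnj_def algebra_simps)
  have "(0, psi (qmult p q) v) = (0 :: real, psi p (psi q v))"
    unfolding psi_quat[OF qmult_S3[OF assms]] psi_quat[OF assms(1)] psi_quat[OF assms(2)] c
    by (simp only: qmult_assoc)
  then show ?thesis by simp
qed

lemma psi_qone: "psi qone v = v"
  using psi_quat[OF qone_S3, of v] by (simp add: qcnj_def quat_simps qone_def)

lemma psi_qcnj:
  assumes "q \<in> S3"
  shows "psi q (psi (qcnj q) v) = v" "psi (qcnj q) (psi q v) = v"
  using assms by (simp_all add: qcnj_S3 qmult_qcnj psi_qone flip: psi_mult)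

lemma psi_explicit:
  assumes "q \<in> S3"
  shows "psi q v = (fst q * fst q - snd q \<bullet> snd q) *\<^sub>R v + (2 * (snd q \<bullet> v)) *\<^sub>R snd q
    + (2 * fst q) *\<^sub>R cross3 (snd q) v"
  unfolding psi_def qinverse_S3[OF assms]
  by (simp add: quat_simps qcnj_def algebra_simps)

lemma orthogonal_transformation_psi:
  assumes "q \<in> S3"
  shows "orthogonal_transformation (psi q)"
proof -
  have "linear (psi q)"
    unfolding psi_def qmult_def
    by (rule linearI)
      (simp_all add: vec_eq_iff forall_3 cross3_def inner_vec_def sum_3 algebra_simps)
  moreover have "psi q v \<bullet> psi q v = v \<bullet> v" for v
  proof -
    have "psi q v \<bullet> psi q v =
        (fst q * fst q + snd q \<bullet> snd q) * (fst q * fst q + snd q \<bullet> snd q) * (v \<bullet> v)"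
      unfolding psi_explicit[OF assms]
      by (simp add: cross3_def inner_vec_def sum_3) algebra
    then show ?thesis using assms by (simp add: S3_iff)
  qed
  ultimately show ?thesis by (simp add: orthogonal_transformation norm_eq_sqrt_inner)
qed

lemma det_psi:
  assumes "q \<in> S3"
  shows "det (matrix (psi q)) = 1"
proof -
  have "det (matrix (psi q)) = (fst q * fst q + snd q \<bullet> snd q) ^ 3"
    unfolding psi_explicit[OF assms] matrix_def
    by (simp add: det_3 cross3_def inner_vec_def sum_3 axis_def) algebra
  then show ?thesis using assms by (simp add: S3_iff)
qed

lemma psi_SO3: "q \<in> S3 \<Longrightarrow> psi q \<in> SO3"
  by (simp add: SO3_def orthogonal_transformation_psi det_psi)

text \<open>The axis of \<open>psi q\<close> is spanned by the imaginary part of \<open>q\<close>.\<close>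

lemma psi_fixed_iff:
  assumes "q \<in> S3"
  shows "psi q v = v \<longleftrightarrow> cross3 (snd q) v = 0"
proof
  assume v: "psi q v = v"
  have "qmult (0, v) q = qmult (qmult (qmult q (0, v)) (qcnj q)) q"
    using psi_quat[OF assms, of v] v by simp
  also have "\<dots> = qmult q (0, v)"
    by (simp add: qmult_assoc qmult_qcnj[OF assms])
  finally show "cross3 (snd q) v = 0"
    by (auto simp: quat_simps mult.commute)
next
  assume c: "cross3 (snd q) v = 0"
  then have "(snd q \<bullet> v) *\<^sub>R snd q = (snd q \<bullet> snd q) *\<^sub>R v"
    using Lagrange[of "snd q" "snd q" v] by simp
  then have "(2 * (snd q \<bullet> v)) *\<^sub>R snd q = (2 * (snd q \<bullet> snd q)) *\<^sub>R v"
    by (simp only: scaleR_scaleR[symmetric])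
  then have "psi q v = (fst q * fst q + snd q \<bullet> snd q) *\<^sub>R v"
    unfolding psi_explicit[OF assms] c by (simp flip: scaleR_add_left)
  then show "psi q v = v" using assms by (simp add: S3_iff)
qed

lemma psi_eq_id_iff:
  assumes "q \<in> S3"
  shows "psi q = id \<longleftrightarrow> snd q = 0"
proof
  assume "psi q = id"
  then have "cross3 (snd q) v = 0" for v
    using psi_fixed_iff[OF assms, of v] by simp
  from this[of "axis 1 1"] this[of "axis 2 1"] show "snd q = 0"
    by (simp add: cross3_def vec_eq_iff forall_3 axis_def)
next
  assume "snd q = 0"
  then show "psi q = id"
    using psi_fixed_iff[OF assms] by (auto simp: fun_eq_iff)
qed

section \<open>The dodecahedron and its symmetries\<close>

text \<open>The radius of the inscribed ball, which touches the faces at their centres.\<close>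

definition inradius :: real where
  "inradius = (dod_x + dod_y) / sqrt 3"

lemma dod_x_pos: "dod_x > 0"
  using dod_y_pos golden_gt_1 by (simp add: dod_x_eq_golden)

lemma dod_y_less_x: "dod_y < dod_x"
  using dod_y_pos golden_gt_1 by (simp add: dod_x_eq_golden)

lemma dod_xy_square: "dod_x * dod_x + dod_y * dod_y = 1"
proof -
  have "dod_x * dod_x + dod_y * dod_y = dod_y * dod_y * (golden * golden + 1)"
    by (simp add: dod_x_eq_golden algebra_simps)
  then show ?thesis using dod_y_square golden_square by (simp add: add.commute)
qed

lemma inradius_pos: "inradius > 0"
  using dod_x_pos dod_y_pos by (simp add: inradius_def)

lemma face_directions_eq:
  "face_directions = {vector [dod_x, dod_y, 0], vector [dod_x, - dod_y, 0],
     vector [- dod_x, dod_y, 0], vector [- dod_x, - dod_y, 0],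
     vector [0, dod_x, dod_y], vector [0, dod_x, - dod_y],
     vector [0, - dod_x, dod_y], vector [0, - dod_x, - dod_y],
     vector [dod_y, 0, dod_x], vector [dod_y, 0, - dod_x],
     vector [- dod_y, 0, dod_x], vector [- dod_y, 0, - dod_x]}"
proof -
  have *: "{f s t | s t. s \<in> {- 1, 1} \<and> t \<in> {- 1, 1}} =
      {f 1 1, f 1 (- 1), f (- 1) 1, f (- 1) (- 1)}"
    for f :: "real \<Rightarrow> real \<Rightarrow> real ^ 3" by auto
  show ?thesis unfolding face_directions_def * by auto
qed

lemma finite_face_directions: "finite face_directions"
  by (simp add: face_directions_eq)

lemma face_directions_unit: "n \<in> face_directions \<Longrightarrow> n \<bullet> n = 1"
  using dod_xy_square by (auto simp: face_directions_def inner_vec_def sum_3)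

lemma norm_face_direction: "n \<in> face_directions \<Longrightarrow> norm n = 1"
  by (simp add: face_directions_unit norm_eq_1)

lemma uminus_face_directions:
  assumes "n \<in> face_directions"
  shows "- n \<in> face_directions"
proof -
  have "- (vector [a, b, c] :: real ^ 3) = vector [- a, - b, - c]" for a b c
    by (simp add: vec_eq_iff forall_3)
  with assms show ?thesis unfolding face_directions_eq by auto
qed

lemma mem_dodecahedron:
  "v \<in> dodecahedron \<longleftrightarrow> (\<forall>n \<in> face_directions. n \<bullet> v \<le> inradius)"
  by (simp add: dodecahedron_def inradius_def)

text \<open>The twelve inequalities combine to three in the absolute values of the coordinates.\<close>

lemma mem_dodecahedron_coords:
  "v \<in> dodecahedron \<longleftrightarrow>
     dod_x * \<bar>v $ 1\<bar> + dod_y * \<bar>v $ 2\<bar> \<le> inradius \<and>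
     dod_x * \<bar>v $ 2\<bar> + dod_y * \<bar>v $ 3\<bar> \<le> inradius \<and>
     dod_y * \<bar>v $ 1\<bar> + dod_x * \<bar>v $ 3\<bar> \<le> inradius"
proof -
  have abs: "r * \<bar>a\<bar> + s * \<bar>b\<bar> \<le> d \<longleftrightarrow>
      r * a + s * b \<le> d \<and> r * a - s * b \<le> d \<and> - r * a + s * b \<le> d \<and> - r * a - s * b \<le> d"
    if "r > 0" "s > 0" for r s a b d :: real
  proof -
    have "r * \<bar>a\<bar> = \<bar>r * a\<bar>" "s * \<bar>b\<bar> = \<bar>s * b\<bar>" using that by (simp_all add: abs_mult)
    then show ?thesis by (auto simp: abs_if)
  qed
  show ?thesis
    unfolding mem_dodecahedron face_directions_eq abs[OF dod_x_pos dod_y_pos] abs[OF dod_y_pos dod_x_pos]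
    by (auto simp: inner_vec_def sum_3)
qed

lemma dodecahedron_Inter:
  "dodecahedron = (\<Inter>n \<in> face_directions. {v. n \<bullet> v \<le> inradius})"
  by (auto simp: mem_dodecahedron)

lemma polyhedron_dodecahedron: "polyhedron dodecahedron"
  unfolding dodecahedron_Inter
  by (intro polyhedron_Inter finite_imageI finite_face_directions)
    (auto simp: polyhedron_halfspace_le)

lemma convex_dodecahedron: "convex dodecahedron"
  by (rule polyhedron_imp_convex[OF polyhedron_dodecahedron])

lemma open_part_interior:
  assumes "\<forall>n \<in> face_directions. n \<bullet> v < inradius"
  shows "v \<in> interior dodecahedron"
proof (rule interiorI)
  show "open (\<Inter>n \<in> face_directions. {v. n \<bullet> v < inradius})"
    by (intro open_INT finite_face_directions ballI open_halfspace_lt)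
qed (use assms in \<open>auto simp: mem_dodecahedron less_imp_le\<close>)

lemma zero_interior: "0 \<in> interior dodecahedron"
  using inradius_pos by (intro open_part_interior) simp

lemma aff_dim_dodecahedron: "aff_dim dodecahedron = 3"
  using aff_dim_nonempty_interior[of dodecahedron] zero_interior by auto

lemma compact_dodecahedron: "compact dodecahedron"
proof -
  have "bounded dodecahedron"
  proof (rule boundedI)
    fix v assume v: "v \<in> dodecahedron"
    have "dod_x * \<bar>v $ i\<bar> \<le> inradius" for i
    proof -
      have "dod_y * \<bar>v $ 1\<bar> \<ge> 0" "dod_y * \<bar>v $ 2\<bar> \<ge> 0" "dod_y * \<bar>v $ 3\<bar> \<ge> 0"
        using dod_y_pos by auto
      then have "dod_x * \<bar>v $ 1\<bar> \<le> inradius \<and> dod_x * \<bar>v $ 2\<bar> \<le> inradius \<and>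
          dod_x * \<bar>v $ 3\<bar> \<le> inradius"
        using v unfolding mem_dodecahedron_coords by linarith
      then show ?thesis using exhaust_3[of i] by auto
    qed
    then have "\<bar>v $ i\<bar> \<le> inradius / dod_x" for i
      using dod_x_pos by (simp add: field_simps)
    then have "(\<Sum>i\<in>UNIV. \<bar>v $ i\<bar>) \<le> (\<Sum>i\<in>(UNIV::3 set). inradius / dod_x)"
      by (rule sum_mono)
    then show "norm v \<le> (\<Sum>i\<in>(UNIV::3 set). inradius / dod_x)"
      using norm_le_l1_cart[of v] by linarith
  qed
  then show ?thesis
    by (simp add: compact_eq_bounded_closed polyhedron_imp_closed polyhedron_dodecahedron)
qed

lemma uminus_dodecahedron: "v \<in> dodecahedron \<Longrightarrow> - v \<in> dodecahedron"
  by (simp add: mem_dodecahedron_coords)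

text \<open>The face directions can be recovered from the dodecahedron as the unit vectors in whose
  direction the inscribed ball reaches the boundary. Hence a linear isometry preserves the one
  exactly when it preserves the other.\<close>

lemma face_direction_iff:
  "n \<in> face_directions \<longleftrightarrow> norm n = 1 \<and> (\<forall>t > inradius. t *\<^sub>R n \<notin> dodecahedron)"
proof
  assume n: "n \<in> face_directions"
  have "t *\<^sub>R n \<notin> dodecahedron" if "t > inradius" for t
    using n that face_directions_unit[OF n] by (auto simp: mem_dodecahedron intro!: bexI[of _ n])
  then show "norm n = 1 \<and> (\<forall>t > inradius. t *\<^sub>R n \<notin> dodecahedron)"
    using norm_face_direction[OF n] by blast
next
  assume n: "norm n = 1 \<and> (\<forall>t > inradius. t *\<^sub>R n \<notin> dodecahedron)"
  show "n \<in> face_directions"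
  proof (rule ccontr)
    assume notin: "n \<notin> face_directions"
    \<comment> \<open>\<open>M < 1\<close> bounds the cosines of the angles between \<open>n\<close> and the face directions, so the
      dodecahedron reaches as far as \<open>inradius / M\<close> in the direction \<open>n\<close>; the bound \<open>1 / 2\<close>
      only keeps \<open>M\<close> positive\<close>
    define M where "M = Max (insert (1 / 2) ((\<lambda>m. m \<bullet> n) ` face_directions))"
    have fin: "finite (insert (1 / 2) ((\<lambda>m. m \<bullet> n) ` face_directions))"
      using finite_face_directions by simp
    have "m \<bullet> n < 1" if "m \<in> face_directions" for m
    proof -
      have "m \<bullet> n \<le> 1" using norm_cauchy_schwarz[of m n] n norm_face_direction[OF that] by simp
      moreover have "m \<bullet> n \<noteq> 1"
        using norm_cauchy_schwarz_eq[of m n] n norm_face_direction[OF that] notin that by auto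
      ultimately show ?thesis by simp
    qed
    then have "M < 1" unfolding M_def using fin by (subst Max_less_iff) auto
    have "M \<ge> 1 / 2" unfolding M_def using fin by (intro Max_ge) auto
    have le: "m \<bullet> n \<le> M" if "m \<in> face_directions" for m
      unfolding M_def using fin that by simp
    have "(inradius / M) *\<^sub>R n \<in> dodecahedron"
      unfolding mem_dodecahedron
    proof
      fix m assume "m \<in> face_directions"
      then have "(inradius / M) * (m \<bullet> n) \<le> (inradius / M) * M"
        using le inradius_pos \<open>M \<ge> 1 / 2\<close> by (intro mult_left_mono) auto
      then show "m \<bullet> (inradius / M) *\<^sub>R n \<le> inradius" using \<open>M \<ge> 1 / 2\<close> by simp
    qed
    moreover have "inradius / M > inradius"
      using \<open>M < 1\<close> \<open>M \<ge> 1 / 2\<close> inradius_pos by (simp add: field_simps)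
    ultimately show False using n by blast
  qed
qed

lemma orthogonal_image_dodecahedron_iff:
  assumes g: "orthogonal_transformation g"
  shows "g ` dodecahedron = dodecahedron \<longleftrightarrow> g ` face_directions \<subseteq> face_directions"
proof
  have lin: "linear g" and inj: "inj g"
    using g orthogonal_transformation_linear orthogonal_transformation_inj by blast+
  {
    assume D: "g ` dodecahedron = dodecahedron"
    show "g ` face_directions \<subseteq> face_directions"
    proof (rule image_subsetI)
      fix n assume n: "n \<in> face_directions"
      have "t *\<^sub>R g n \<notin> dodecahedron" if "t > inradius" for t
      proof -
        have "t *\<^sub>R n \<notin> dodecahedron" using n that face_direction_iff by blast
        then have "g (t *\<^sub>R n) \<notin> g ` dodecahedron" using inj by (simp add: inj_image_mem_iff)
        then show ?thesis using D lin by (simp add: linear_cmul)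
      qed
      moreover have "norm (g n) = 1"
        using norm_face_direction[OF n] g by (simp add: orthogonal_transformation)
      ultimately show "g n \<in> face_directions" by (simp add: face_direction_iff)
    qed
  next
    assume "g ` face_directions \<subseteq> face_directions"
    then have F: "g ` face_directions = face_directions"
      by (intro endo_inj_surj finite_face_directions) (auto intro: inj_on_subset[OF inj])
    have iff: "g v \<in> dodecahedron \<longleftrightarrow> v \<in> dodecahedron" for v
    proof -
      have "g v \<in> dodecahedron \<longleftrightarrow> (\<forall>n \<in> g ` face_directions. n \<bullet> g v \<le> inradius)"
        by (simp add: mem_dodecahedron F)
      then show ?thesis using g by (simp add: mem_dodecahedron orthogonal_transformation_def)
    qed
    have "v \<in> g ` dodecahedron" if "v \<in> dodecahedron" for v
    proof -
      obtain w where "v = g w" using orthogonal_transformation_surj[OF g] by (auto elim: surjE)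
      then show ?thesis using that iff by blast
    qed
    then show "g ` dodecahedron = dodecahedron" using iff by blast
  }
qed

section \<open>The binary dodecahedral group\<close>

lemma bin_dod_iff: "q \<in> bin_dod \<longleftrightarrow> q \<in> S3 \<and> psi q ` face_directions \<subseteq> face_directions"
  by (cases "q \<in> S3") (simp_all add: bin_dod_def dod_group_def psi_SO3
      orthogonal_image_dodecahedron_iff orthogonal_transformation_psi)

lemma bin_dod_S3: "q \<in> bin_dod \<Longrightarrow> q \<in> S3"
  by (simp add: bin_dod_def)

lemma psi_image_dodecahedron: "q \<in> bin_dod \<Longrightarrow> psi q ` dodecahedron = dodecahedron"
  by (simp add: bin_dod_def dod_group_def)

lemma qone_bin_dod: "qone \<in> bin_dod"
  by (auto simp: bin_dod_iff qone_S3 psi_qone)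

lemma qmult_bin_dod:
  assumes "p \<in> bin_dod" "q \<in> bin_dod"
  shows "qmult p q \<in> bin_dod"
  using assms by (auto simp: bin_dod_iff qmult_S3 psi_mult)

lemma qcnj_bin_dod:
  assumes "q \<in> bin_dod"
  shows "qcnj q \<in> bin_dod"
proof -
  have q: "q \<in> S3" using assms by (rule bin_dod_S3)
  have "psi (qcnj q) ` dodecahedron = psi (qcnj q) ` psi q ` dodecahedron"
    by (simp add: psi_image_dodecahedron[OF assms])
  also have "\<dots> = dodecahedron"
    by (simp add: image_image psi_qcnj[OF q])
  finally show ?thesis
    using q by (simp add: bin_dod_def dod_group_def psi_SO3 qcnj_S3)
qed

lemma group_bin_dod: "group bin_dod_group"
proof (rule groupI)
  fix q assume "q \<in> carrier bin_dod_group"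
  then have "q \<in> bin_dod" by (simp add: bin_dod_group_def)
  then show "\<exists>p \<in> carrier bin_dod_group. p \<otimes>\<^bsub>bin_dod_group\<^esub> q = \<one>\<^bsub>bin_dod_group\<^esub>"
    using qcnj_bin_dod qmult_qcnj bin_dod_S3
    by (intro bexI[of _ "qcnj q"]) (auto simp: bin_dod_group_def)
qed (auto simp: bin_dod_group_def qmult_bin_dod qone_bin_dod qmult_assoc)

section \<open>Types of rotations\<close>

text \<open>The points of the dodecahedron through which the axis of a rotation of the given type
  passes. There are none for the identity, whose type is not defined by an axis.\<close>

fun class_points :: "rotation_type \<Rightarrow> (real ^ 3) set" where
  "class_points Identity = {}"
| "class_points Face = dod_face_centres"
| "class_points Vertex = dod_vertices"
| "class_points Edge = dod_edge_midpoints"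

lemma has_rotation_type_iff:
  "has_rotation_type g T \<longleftrightarrow>
     (if T = Identity then g = id else g \<noteq> id \<and> {v. g v = v} \<inter> class_points T \<noteq> {})"
  by (cases T) auto

lemma extreme_points_linear_image:
  assumes h: "linear h" "inj h"
  shows "{v. v extreme_point_of (h ` G)} = h ` {v. v extreme_point_of G}"
proof -
  have "h v extreme_point_of (h ` G) \<longleftrightarrow> v extreme_point_of G" for v
    using face_of_linear_image[OF h, of "{v}" G] by (simp add: face_of_singleton)
  moreover have "w \<in> h ` G" if "w extreme_point_of (h ` G)" for w
    using that by (simp add: extreme_point_of_def)
  ultimately show ?thesis by blast
qed

text \<open>Stated for arbitrary linear symmetries of the dodecahedron, so that it applies to the
  rotations \<open>psi q\<close> as well as to the point reflection.\<close>

lemma class_points_linear_image: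
  assumes h: "linear h" "inj h" and D: "h ` dodecahedron = dodecahedron" and w: "w \<in> class_points T"
  shows "h w \<in> class_points T"
proof -
  have face: "h ` G face_of dodecahedron" if "G face_of dodecahedron" for G
    using face_of_linear_image[OF h, of G dodecahedron] that D by simp
  show ?thesis
  proof (cases T)
    case Identity
    then show ?thesis using w by simp
  next
    case Vertex
    then show ?thesis
      using w face[of "{w}"] by (simp add: dod_vertices_def face_of_singleton)
  next
    case Edge
    then obtain a b where ab: "w = midpoint a b" "closed_segment a b edge_of dodecahedron"
      using w by (auto simp: dod_edge_midpoints_def)
    have "closed_segment (h a) (h b) = h ` closed_segment a b"
      using h by (simp add: closed_segment_linear_image)
    then have "closed_segment (h a) (h b) edge_of dodecahedron"
      using ab(2) face h by (simp add: edge_of_def)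
    moreover have "h w = midpoint (h a) (h b)"
      using h by (simp add: ab(1) midpoint_linear_image)
    ultimately show ?thesis using Edge by (auto simp: dod_edge_midpoints_def)
  next
    case Face
    then obtain G where G: "w = centroid G" "G facet_of dodecahedron"
      using w by (auto simp: dod_face_centres_def)
    have "h ` G facet_of dodecahedron"
      using G(2) face h by (simp add: facet_of_def)
    have ext: "{v. v extreme_point_of (h ` G)} = h ` {v. v extreme_point_of G}"
      by (rule extreme_points_linear_image[OF h])
    have "inj_on h A" for A using h(2) by (simp add: inj_on_def)
    then have "h w = centroid (h ` G)"
      unfolding centroid_def G(1) ext using h(1)
      by (simp add: card_image sum.reindex linear_sum linear_cmul)
    then show ?thesis
      using Face \<open>h ` G facet_of dodecahedron\<close> by (auto simp: dod_face_centres_def)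
  qed
qed

text \<open>The point \<open>w\<close> lies in the relative interior of a face of dimension \<open>d\<close> of the
  dodecahedron. The relative interiors of different faces are disjoint, so \<open>w\<close> determines \<open>d\<close>.\<close>

definition in_face_interior :: "int \<Rightarrow> real ^ 3 \<Rightarrow> bool" where
  "in_face_interior d w \<longleftrightarrow>
     (\<exists>G. G face_of dodecahedron \<and> aff_dim G = d \<and> w \<in> rel_interior G)"

text \<open>The dimension of the faces that have the points of a class in their relative interiors.
  The value for the identity is arbitrary, since its class is empty; with the value 3 the
  dimension tells all types apart.\<close>

fun class_dim :: "rotation_type \<Rightarrow> int" where
  "class_dim Identity = 3"
| "class_dim Face = 2"
| "class_dim Vertex = 0"
| "class_dim Edge = 1"

text \<open>A polytope is the convex hull of its extreme points, and a convex combination of them with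
  positive coefficients lies in the relative interior.\<close>

lemma centroid_in_rel_interior:
  assumes "polyhedron G" "compact G" "G \<noteq> {}"
  shows "centroid G \<in> rel_interior G"
proof -
  define E where "E = {v. v extreme_point_of G}"
  have conv: "convex G" using assms(1) by (rule polyhedron_imp_convex)
  have fin: "finite E" unfolding E_def by (rule finite_polyhedron_extreme_points[OF assms(1)])
  have G: "G = convex hull E" unfolding E_def by (rule Krein_Milman_Minkowski[OF assms(2) conv])
  have "card E > 0" using G fin assms(3) by (auto simp: card_gt_0_iff)
  have "centroid G = (\<Sum>v\<in>E. (1 / real (card E)) *\<^sub>R v)"
    by (simp add: centroid_def E_def scaleR_sum_right)
  then show ?thesis
    using explicit_subset_rel_interior_convex_hull_minimal[OF fin] \<open>card E > 0\<close>
      unfolding G[symmetric]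
    by (auto intro!: exI[of _ "\<lambda>_. 1 / real (card E)"])
qed

lemma class_points_in_face_interior:
  assumes w: "w \<in> class_points T"
  shows "in_face_interior (class_dim T) w"
proof (cases T)
  case Identity
  then show ?thesis using w by simp
next
  case Vertex
  then have "{w} face_of dodecahedron" using w by (simp add: dod_vertices_def face_of_singleton)
  then show ?thesis using Vertex by (auto simp: in_face_interior_def intro!: exI[of _ "{w}"])
next
  case Edge
  then obtain a b where ab: "w = midpoint a b" "closed_segment a b edge_of dodecahedron"
    using w by (auto simp: dod_edge_midpoints_def)
  then have "a \<noteq> b" by (auto simp: edge_of_def)
  then have "w \<in> rel_interior (closed_segment a b)"
    by (simp add: ab(1) rel_interior_closed_segment)
  then show ?thesis using ab(2) Edge by (auto simp: in_face_interior_def edge_of_def)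
next
  case Face
  then obtain G where G: "w = centroid G" "G face_of dodecahedron" "G \<noteq> {}" "aff_dim G = 2"
    using w by (auto simp: dod_face_centres_def facet_of_def aff_dim_dodecahedron)
  have "polyhedron G" using G(2) polyhedron_dodecahedron face_of_polyhedron_polyhedron by blast
  moreover have "compact G"
    using G(2) face_of_imp_compact compact_dodecahedron convex_dodecahedron by blast
  ultimately have "w \<in> rel_interior G" using centroid_in_rel_interior G(1,3) by blast
  then show ?thesis using G Face by (auto simp: in_face_interior_def)
qed

lemma in_face_interior_unique:
  "in_face_interior d w \<Longrightarrow> in_face_interior e w \<Longrightarrow> d = e"
  unfolding in_face_interior_def using face_of_eq by (metis IntI empty_iff)

lemma in_face_interior_boundary:
  assumes "in_face_interior d w" "d \<noteq> 3"
  shows "w \<in> dodecahedron \<and> (\<exists>n \<in> face_directions. n \<bullet> w = inradius)"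
proof -
  obtain G where G: "G face_of dodecahedron" "aff_dim G = d" "w \<in> rel_interior G"
    using assms(1) by (auto simp: in_face_interior_def)
  have "w \<in> G" using G(3) rel_interior_subset by blast
  then have w: "w \<in> dodecahedron" using G(1) face_of_imp_subset by blast
  have "G \<noteq> dodecahedron" using G(2) assms(2) aff_dim_dodecahedron by auto
  then have "w \<notin> interior dodecahedron"
    using face_of_disjoint_interior[OF G(1)] \<open>w \<in> G\<close> by blast
  then obtain n where "n \<in> face_directions" "\<not> n \<bullet> w < inradius"
    using open_part_interior by blast
  then show ?thesis using w by (auto simp: mem_dodecahedron intro!: bexI[of _ n] order_antisym)
qed

text \<open>A line through the origin meets the boundary of the dodecahedron in two opposite points
  only.\<close>

lemma boundary_points_on_line:
  assumes w: "w \<in> dodecahedron" "n \<in> face_directions" "n \<bullet> w = inradius"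
    and w': "t *\<^sub>R w \<in> dodecahedron" "n' \<in> face_directions" "n' \<bullet> (t *\<^sub>R w) = inradius"
  shows "t = 1 \<or> t = - 1"
proof -
  have bound: "\<bar>m \<bullet> v\<bar> \<le> inradius" if "v \<in> dodecahedron" "m \<in> face_directions" for m v
  proof -
    have "m \<bullet> v \<le> inradius" "(- m) \<bullet> v \<le> inradius"
      using that uminus_face_directions[OF that(2)] by (simp_all only: mem_dodecahedron)
    then show ?thesis by (simp add: abs_le_iff)
  qed
  have "\<bar>t\<bar> * inradius \<le> inradius"
    using bound[OF w'(1) w(2)] w(3) inradius_pos by (simp add: abs_mult)
  then have "\<bar>t\<bar> \<le> 1" using inradius_pos by simp
  moreover have "inradius \<le> \<bar>t\<bar> * inradius"
  proof -
    have "inradius = \<bar>t\<bar> * \<bar>n' \<bullet> w\<bar>"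
      using w'(3) inradius_pos by (simp flip: abs_mult)
    also have "\<dots> \<le> \<bar>t\<bar> * inradius" by (intro mult_left_mono bound w w') simp
    finally show ?thesis .
  qed
  then have "\<bar>t\<bar> \<ge> 1" using inradius_pos by simp
  ultimately show ?thesis by linarith
qed

text \<open>By the Lagrange identity for \<open>u \<times> (u \<times> w)\<close>.\<close>

lemma axis_multiple:
  assumes "u \<noteq> 0" "cross3 u w = 0"
  shows "w = ((u \<bullet> w) / (u \<bullet> u)) *\<^sub>R u"
proof -
  have "(u \<bullet> w) *\<^sub>R u = (u \<bullet> u) *\<^sub>R w"
    using Lagrange[of u u w] assms(2) by simp
  then have "((u \<bullet> w) / (u \<bullet> u)) *\<^sub>R u = (1 / (u \<bullet> u)) *\<^sub>R ((u \<bullet> u) *\<^sub>R w)"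
    by (metis divide_inverse_commute inverse_eq_divide scaleR_scaleR)
  then show ?thesis using assms(1) by simp
qed

lemma linear_uminus_real3: "linear (uminus :: real ^ 3 \<Rightarrow> real ^ 3)"
  by (rule linearI) simp_all

text \<open>Points of two classes on a common axis are equal or opposite, so by the symmetry of the
  classes under the point reflection they lie in both classes, and the dimensions of the faces
  agree.\<close>

theorem rotation_type_unique:
  assumes q: "q \<in> S3"
    and T: "has_rotation_type (psi q) T" and T': "has_rotation_type (psi q) T'"
  shows "T = T'"
proof (cases "psi q = id")
  case True
  then show ?thesis using T T' by (simp add: has_rotation_type_iff split: if_splits)
next
  case False
  then have u: "snd q \<noteq> 0" using psi_eq_id_iff[OF q] by simp
  have ne: "T \<noteq> Identity" "T' \<noteq> Identity"
    using False T T' by (auto simp: has_rotation_type_iff)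
  obtain w where w: "psi q w = w" "w \<in> class_points T"
    using T ne by (auto simp: has_rotation_type_iff)
  obtain w' where w': "psi q w' = w'" "w' \<in> class_points T'"
    using T' ne by (auto simp: has_rotation_type_iff)
  have dim: "class_dim T \<noteq> 3" "class_dim T' \<noteq> 3"
    using ne by (cases T; simp) (use ne in \<open>cases T'; simp\<close>)
  note wi = class_points_in_face_interior[OF w(2)]
  note wi' = class_points_in_face_interior[OF w'(2)]
  obtain n where n: "w \<in> dodecahedron" "n \<in> face_directions" "n \<bullet> w = inradius"
    using in_face_interior_boundary[OF wi dim(1)] by blast
  obtain n' where n': "w' \<in> dodecahedron" "n' \<in> face_directions" "n' \<bullet> w' = inradius"
    using in_face_interior_boundary[OF wi' dim(2)] by blast
  obtain s where s: "w = s *\<^sub>R snd q"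
    using axis_multiple[OF u] w(1) psi_fixed_iff[OF q] by blast
  obtain s' where s': "w' = s' *\<^sub>R snd q"
    using axis_multiple[OF u] w'(1) psi_fixed_iff[OF q] by blast
  have "w \<noteq> 0" using n inradius_pos by auto
  then have "s \<noteq> 0" using s by auto
  then have t: "w' = (s' / s) *\<^sub>R w" using s s' by simp
  have "w' = w \<or> w' = - w"
    using boundary_points_on_line[OF n n'[unfolded t]] t by auto
  then have "w \<in> class_points T'"
  proof
    assume m: "w' = - w"
    have D: "uminus ` dodecahedron = dodecahedron"
      using uminus_dodecahedron by (force simp: image_iff)
    from class_points_linear_image[OF linear_uminus_real3 _ D w'(2)] m
    show ?thesis by (simp add: inj_def)
  qed (use w' in simp)
  then have "class_dim T = class_dim T'"
    using class_points_in_face_interior in_face_interior_unique wi by blast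
  then show ?thesis by (cases T; cases T'; simp)
qed

lemma conjugate_class_point:
  assumes g: "g \<in> bin_dod" and w: "w \<in> class_points T"
  shows "psi g w \<in> class_points T"
proof (rule class_points_linear_image[OF _ _ psi_image_dodecahedron[OF g] w])
  have "orthogonal_transformation (psi g)"
    using bin_dod_S3[OF g] by (rule orthogonal_transformation_psi)
  then show "linear (psi g)" "inj (psi g)"
    using orthogonal_transformation_linear orthogonal_transformation_inj by blast+
qed

lemma has_rotation_type_conjugate:
  assumes g: "g \<in> bin_dod" and r: "r \<in> S3" and T: "has_rotation_type (psi r) T"
  shows "has_rotation_type (psi (qmult (qmult g r) (qcnj g))) T"
proof -
  have gS: "g \<in> S3" "qcnj g \<in> S3" using g by (simp_all add: bin_dod_S3 qcnj_S3)
  have eq: "psi (qmult (qmult g r) (qcnj g)) v = psi g (psi r (psi (qcnj g) v))" for v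
    using gS r by (simp add: psi_mult qmult_S3)
  show ?thesis
  proof (cases "T = Identity")
    case True
    then show ?thesis using T gS by (auto simp: has_rotation_type_iff fun_eq_iff eq psi_qcnj)
  next
    case False
    then obtain w where w: "psi r w = w" "w \<in> class_points T" and "psi r \<noteq> id"
      using T by (auto simp: has_rotation_type_iff)
    then obtain v where "psi r v \<noteq> v" by (auto simp: fun_eq_iff)
    then have "psi (qmult (qmult g r) (qcnj g)) (psi g v) \<noteq> psi g v"
      using gS by (metis eq psi_qcnj(2))
    moreover have "psi (qmult (qmult g r) (qcnj g)) (psi g w) = psi g w"
      using gS w by (simp add: eq psi_qcnj)
    ultimately show ?thesis
      using False conjugate_class_point[OF g w(2)] by (auto simp: has_rotation_type_iff)
  qed
qed

text \<open>The sum of the directions of the three faces at the vertex is a positive multiple of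
  \<open>(1, 1, 1)\<close>. So on the dodecahedron the linear functional \<open>(1, 1, 1)\<close> attains its maximum exactly
  where the three inequalities are equalities, which is in one point.\<close>

lemma vertex_111: "(1 / sqrt 3) *\<^sub>R vector [1, 1, 1] \<in> dod_vertices"
proof -
  let ?w = "(1 / sqrt 3) *\<^sub>R vector [1, 1, 1] :: real ^ 3"
  have 3: "sqrt 3 * sqrt 3 = (3::real)" by simp
  define G where "G = dodecahedron \<inter> {v. vector [1, 1, 1] \<bullet> v = sqrt 3}"
  have sum: "dod_x * v $ 1 + dod_y * v $ 2 \<le> inradius" "dod_x * v $ 2 + dod_y * v $ 3 \<le> inradius"
    "dod_y * v $ 1 + dod_x * v $ 3 \<le> inradius" if "v \<in> dodecahedron" for v
    using that unfolding mem_dodecahedron face_directions_eq by (auto simp: inner_vec_def sum_3)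
  have le: "v $ 1 + v $ 2 + v $ 3 \<le> sqrt 3" and
    eq: "v $ 1 + v $ 2 + v $ 3 = sqrt 3 \<Longrightarrow> v = ?w" if v: "v \<in> dodecahedron" for v
  proof -
    note * = sum[OF v]
    have K: "3 * inradius = (dod_x + dod_y) * sqrt 3"
      by (simp add: inradius_def field_simps)
    have "(dod_x + dod_y) * (v $ 1 + v $ 2 + v $ 3) \<le> (dod_x + dod_y) * sqrt 3"
      using * K by (simp add: algebra_simps)
    then show "v $ 1 + v $ 2 + v $ 3 \<le> sqrt 3"
      using dod_x_pos dod_y_pos by simp
    assume s: "v $ 1 + v $ 2 + v $ 3 = sqrt 3"
    then have "(dod_x + dod_y) * (v $ 1 + v $ 2 + v $ 3) = 3 * inradius"
      using K by simp
    then have e: "dod_x * v $ 1 + dod_y * v $ 2 = inradius"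
      "dod_x * v $ 2 + dod_y * v $ 3 = inradius"
      "dod_y * v $ 1 + dod_x * v $ 3 = inradius"
      using * by (simp_all add: algebra_simps)
    define a b c where d: "a = v $ 1 - 1 / sqrt 3" "b = v $ 2 - 1 / sqrt 3" "c = v $ 3 - 1 / sqrt 3"
    have z: "dod_x * a + dod_y * b = 0" "dod_x * b + dod_y * c = 0" "dod_y * a + dod_x * c = 0"
      using e by (simp_all add: d inradius_def right_diff_distrib add_divide_distrib)
    \<comment> \<open>\<open>x\<^sup>3 + y\<^sup>3\<close> is the determinant of the linear system\<close>
    have "(dod_x ^ 3 + dod_y ^ 3) * a = 0" "(dod_x ^ 3 + dod_y ^ 3) * b = 0"
      "(dod_x ^ 3 + dod_y ^ 3) * c = 0"
      using z by algebra+
    moreover have "dod_x ^ 3 + dod_y ^ 3 > 0" using dod_x_pos dod_y_pos by (simp add: add_pos_pos)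
    ultimately have "a = 0" "b = 0" "c = 0" by auto
    then show "v = ?w" by (simp add: d vec_eq_iff forall_3)
  qed
  have "?w \<in> dodecahedron"
    using dod_x_pos dod_y_pos by (simp add: mem_dodecahedron_coords inradius_def field_simps)
  moreover have "vector [1, 1, 1] \<bullet> ?w = sqrt 3"
    using 3 by (simp add: inner_vec_def sum_3 field_simps)
  ultimately have "?w \<in> G" unfolding G_def by blast
  moreover have "v = ?w" if "v \<in> G" for v
    using that by (intro eq) (simp_all add: G_def inner_vec_def sum_3)
  ultimately have "G = {?w}" by blast
  moreover have "G face_of dodecahedron"
    unfolding G_def using le
    by (intro face_of_Int_supporting_hyperplane_le convex_dodecahedron)
      (auto simp: inner_vec_def sum_3)
  ultimately show ?thesis by (simp add: dod_vertices_def face_of_singleton)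
qed

text \<open>The functional \<open>(1, 0, 0)\<close> attains its maximum \<open>c\<close> on the dodecahedron along an edge
  parallel to the third axis, of half length \<open>h\<close>.\<close>

lemma edge_midpoint_100: "(inradius / dod_x) *\<^sub>R vector [1, 0, 0] \<in> dod_edge_midpoints"
proof -
  define c where "c = inradius / dod_x"
  define h where "h = (c - c * (dod_y / dod_x))"
  define G where "G = dodecahedron \<inter> {v. vector [1, 0, 0] \<bullet> v = c}"
  have c: "dod_x * c = inradius" "c > 0" using dod_x_pos inradius_pos by (simp_all add: c_def)
  have h: "dod_x * h = inradius - dod_y * c" using dod_x_pos c by (simp add: h_def field_simps)
  have "dod_y * c < dod_x * c" using dod_y_less_x c(2) by (rule mult_strict_right_mono)
  then have "h > 0" using h c dod_x_pos by (metis diff_gt_0_iff_gt zero_less_mult_pos)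
  have "dod_x * h \<le> dod_x * c" using h c dod_y_pos by simp
  then have "h \<le> c" using dod_x_pos by simp
  then have hy: "dod_y * h \<le> inradius"
    using mult_mono[of dod_y dod_x h c] dod_y_less_x dod_y_pos dod_x_pos c \<open>h > 0\<close> \<open>h \<le> c\<close> by simp
  have le: "v $ 1 \<le> c" if "v \<in> dodecahedron" for v
  proof -
    have "dod_y * \<bar>v $ 2\<bar> \<ge> 0" using dod_y_pos by simp
    then have "dod_x * \<bar>v $ 1\<bar> \<le> dod_x * c"
      using that unfolding mem_dodecahedron_coords c by linarith
    then show ?thesis using dod_x_pos by simp
  qed
  have "G face_of dodecahedron"
    unfolding G_def using le
    by (intro face_of_Int_supporting_hyperplane_le convex_dodecahedron)
      (auto simp: inner_vec_def sum_3)
  moreover have G: "G = closed_segment (vector [c, 0, - h]) (vector [c, 0, h])"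
  proof -
    have "v \<in> G \<longleftrightarrow> v $ 1 = c \<and> v $ 2 = 0 \<and> \<bar>v $ 3\<bar> \<le> h" for v
    proof -
      have "v \<in> G \<longleftrightarrow> v $ 1 = c \<and> dod_y * \<bar>v $ 2\<bar> \<le> 0 \<and> dod_x * \<bar>v $ 2\<bar> + dod_y * \<bar>v $ 3\<bar> \<le> inradius
          \<and> dod_x * \<bar>v $ 3\<bar> \<le> dod_x * h"
        using c h by (auto simp: G_def mem_dodecahedron_coords inner_vec_def sum_3)
      also have "\<dots> \<longleftrightarrow> v $ 1 = c \<and> v $ 2 = 0 \<and> \<bar>v $ 3\<bar> \<le> h"
      proof -
        have "dod_y * \<bar>v $ 2\<bar> \<le> 0 \<longleftrightarrow> v $ 2 = 0" using dod_y_pos by (simp add: mult_le_0_iff)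
        moreover have "dod_x * \<bar>v $ 3\<bar> \<le> dod_x * h \<longleftrightarrow> \<bar>v $ 3\<bar> \<le> h" using dod_x_pos by simp
        moreover have "dod_y * \<bar>v $ 3\<bar> \<le> inradius" if "\<bar>v $ 3\<bar> \<le> h"
          using hy mult_left_mono[OF that, of dod_y] dod_y_pos by linarith
        ultimately show ?thesis by auto
      qed
      finally show ?thesis .
    qed
    moreover have "v \<in> closed_segment (vector [c, 0, - h]) (vector [c, 0, h]) \<longleftrightarrow>
        v $ 1 = c \<and> v $ 2 = 0 \<and> \<bar>v $ 3\<bar> \<le> h" for v :: "real ^ 3"
    proof
      assume "v \<in> closed_segment (vector [c, 0, - h]) (vector [c, 0, h])"
      then obtain u where u: "0 \<le> u" "u \<le> 1"
        "v = (1 - u) *\<^sub>R vector [c, 0, - h] + u *\<^sub>R vector [c, 0, h]"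
        by (auto simp: in_segment)
      have "v $ 3 = (2 * u - 1) * h" by (simp add: u(3) algebra_simps)
      then have "\<bar>v $ 3\<bar> = \<bar>2 * u - 1\<bar> * h" using \<open>h > 0\<close> by (simp add: abs_mult)
      moreover have "\<bar>2 * u - 1\<bar> * h \<le> 1 * h"
        using u \<open>h > 0\<close> by (intro mult_right_mono) auto
      ultimately show "v $ 1 = c \<and> v $ 2 = 0 \<and> \<bar>v $ 3\<bar> \<le> h"
        by (simp add: u(3) algebra_simps)
    next
      assume v: "v $ 1 = c \<and> v $ 2 = 0 \<and> \<bar>v $ 3\<bar> \<le> h"
      define u where "u = (v $ 3 + h) / (2 * h)"
      have "0 \<le> u" "u \<le> 1" using v \<open>h > 0\<close> by (auto simp: u_def field_simps abs_le_iff)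
      moreover have "v = (1 - u) *\<^sub>R vector [c, 0, - h] + u *\<^sub>R vector [c, 0, h]"
        using v \<open>h > 0\<close> by (simp add: vec_eq_iff forall_3 u_def field_simps)
      ultimately show "v \<in> closed_segment (vector [c, 0, - h]) (vector [c, 0, h])"
        by (auto simp: in_segment)
    qed
    ultimately show ?thesis by blast
  qed
  moreover have "aff_dim (closed_segment (vector [c, 0, - h]) (vector [c, 0, h]) :: (real ^ 3) set) = 1"
  proof -
    have "vector [c, 0, - h] \<noteq> (vector [c, 0, h] :: real ^ 3)"
      using \<open>h > 0\<close> by (simp add: vec_eq_iff forall_3)
    then show ?thesis by (simp add: segment_convex_hull aff_dim_convex_hull)
  qed
  ultimately have "closed_segment (vector [c, 0, - h]) (vector [c, 0, h]) edge_of dodecahedron"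
    by (simp add: edge_of_def)
  moreover have "midpoint (vector [c, 0, - h]) (vector [c, 0, h]) =
      c *\<^sub>R (vector [1, 0, 0] :: real ^ 3)"
    by (simp add: midpoint_def vec_eq_iff forall_3)
  ultimately show ?thesis unfolding dod_edge_midpoints_def c_def
    by (metis (mono_tags, lifting) mem_Collect_eq)
qed

text \<open>A face is the intersection of the dodecahedron with a supporting plane. Its centroid is
  fixed by every rotation about the normal of this plane that preserves the dodecahedron, so it
  lies on the axis of such a rotation.\<close>

lemma face_centre:
  assumes q: "q \<in> bin_dod" and u: "snd q \<noteq> 0" and f: "f \<in> face_directions"
    and axis: "cross3 (snd q) f = 0"
  shows "inradius *\<^sub>R f \<in> dod_face_centres"
proof -
  define G where "G = dodecahedron \<inter> {v. f \<bullet> v = inradius}"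
  have qS: "q \<in> S3" using q by (rule bin_dod_S3)
  have orth: "orthogonal_transformation (psi q)" using qS by (rule orthogonal_transformation_psi)
  then have lin: "linear (psi q)" "inj (psi q)"
    using orthogonal_transformation_linear orthogonal_transformation_inj by blast+
  have G: "G face_of dodecahedron"
    unfolding G_def using f
    by (intro face_of_Int_supporting_hyperplane_le convex_dodecahedron)
      (auto simp: mem_dodecahedron)
  have ff: "f \<bullet> f = 1" using f by (rule face_directions_unit)
  define U where "U = (\<Inter>n \<in> face_directions - {f}. {v. n \<bullet> v < inradius})"
  have "open U"
    unfolding U_def by (intro open_INT finite_Diff finite_face_directions ballI open_halfspace_lt)
  have inU: "inradius *\<^sub>R f \<in> U"
  proof -
    have "n \<bullet> f < 1" if "n \<in> face_directions" "n \<noteq> f" for n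
      using norm_cauchy_schwarz[of n f] norm_cauchy_schwarz_eq[of n f]
        norm_face_direction[OF f] norm_face_direction[OF that(1)] that(2) by force
    then show ?thesis using inradius_pos by (auto simp: U_def)
  qed
  have sub: "{v. f \<bullet> v = inradius} \<inter> U \<subseteq> G"
    by (force simp: G_def U_def mem_dodecahedron)
  have inH: "inradius *\<^sub>R f \<in> {v. f \<bullet> v = inradius} \<inter> U" using inU ff by simp
  \<comment> \<open>near the point \<open>inradius * f\<close>, where the other eleven inequalities are strict, the face is
    all of the supporting plane\<close>
  have "aff_dim G = 2"
  proof (rule antisym)
    have plane: "aff_dim {v. f \<bullet> v = inradius} = 2"
    proof -
      have "f \<noteq> 0" using ff by auto
      then show ?thesis using aff_dim_hyperplane[of f inradius] by simp
    qed
    show "aff_dim G \<le> 2"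
      using aff_dim_subset[of G "{v. f \<bullet> v = inradius}"] plane by (simp add: G_def)
    have "affine hull ({v. f \<bullet> v = inradius} \<inter> U) = affine hull {v. f \<bullet> v = inradius}"
      using \<open>open U\<close> inH by (intro affine_hull_convex_Int_open convex_hyperplane) blast+
    then show "2 \<le> aff_dim G"
      using aff_dim_subset[OF sub] plane by (metis aff_dim_affine_hull)
  qed
  moreover have "G \<noteq> {}" using sub inH by blast
  ultimately have facet: "G facet_of dodecahedron"
    using G by (simp add: facet_of_def aff_dim_dodecahedron)
  define E where "E = {v. v extreme_point_of G}"
  have "polyhedron G" using G polyhedron_dodecahedron face_of_polyhedron_polyhedron by blast
  then have "finite E" unfolding E_def by (rule finite_polyhedron_extreme_points)
  have "compact G" using G face_of_imp_compact compact_dodecahedron convex_dodecahedron by blast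
  have centroid_G: "centroid G \<in> G"
    using centroid_in_rel_interior[OF \<open>polyhedron G\<close> \<open>compact G\<close> \<open>G \<noteq> {}\<close>] rel_interior_subset
      by blast
  have fix_f: "psi q f = f" using axis psi_fixed_iff[OF qS] by simp
  have "psi q ` G = G"
  proof -
    have "psi q ` {v. f \<bullet> v = inradius} = {v. f \<bullet> v = inradius}"
    proof -
      have "f \<bullet> psi q v = f \<bullet> v" for v
        using orth fix_f by (metis orthogonal_transformation_def)
      then show ?thesis
        using orthogonal_transformation_surj[OF orth] by (force simp: image_iff surj_def)
    qed
    then show ?thesis
      unfolding G_def using psi_image_dodecahedron[OF q] lin(2) by (simp add: image_Int)
  qed
  then have "psi q ` E = E"
    unfolding E_def using extreme_points_linear_image[OF lin, of G] by simp
  then have "psi q (\<Sum>E) = \<Sum>E"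
    using lin by (metis (no_types, lifting) inj_on_subset linear_sum subset_UNIV sum.reindex_cong)
  then have "psi q (centroid G) = centroid G"
    unfolding centroid_def E_def[symmetric] using lin by (simp add: linear_cmul)
  then have "cross3 (snd q) (centroid G) = 0" using psi_fixed_iff[OF qS] by simp
  then obtain s where s: "centroid G = s *\<^sub>R snd q" using axis_multiple[OF u] by blast
  obtain t where t: "f = t *\<^sub>R snd q" using axis_multiple[OF u axis] by blast
  have "f \<bullet> centroid G = inradius" using centroid_G by (simp add: G_def)
  moreover have "t \<noteq> 0" using t ff by auto
  then have "centroid G = (s / t) *\<^sub>R f" using s t by simp
  ultimately have "inradius *\<^sub>R f = centroid G" using ff by simp
  then show ?thesis using facet by (auto simp: dod_face_centres_def)
qed

section \<open>Icosians in integer coordinates\<close>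

text \<open>The pair \<open>(a, b)\<close> of integers stands for the number \<open>a + b \<phi>\<close>, and a quadruple of such
  pairs for the quaternion whose coordinates are half of these numbers.\<close>

type_synonym golden_int = "int \<times> int"
type_synonym icosian = "golden_int \<times> golden_int \<times> golden_int \<times> golden_int"

fun golden_val :: "golden_int \<Rightarrow> real" where
  "golden_val (a, b) = of_int a + of_int b * golden"

fun quat_of :: "icosian \<Rightarrow> quat" where
  "quat_of (a, b, c, d) =
      (golden_val a / 2, vector [golden_val b / 2, golden_val c / 2, golden_val d / 2])"

fun golden_add :: "golden_int \<Rightarrow> golden_int \<Rightarrow> golden_int" where
  "golden_add (a, b) (c, d) = (a + c, b + d)"
fun golden_sub :: "golden_int \<Rightarrow> golden_int \<Rightarrow> golden_int" where
  "golden_sub (a, b) (c, d) = (a - c, b - d)"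
fun golden_neg :: "golden_int \<Rightarrow> golden_int" where "golden_neg (a, b) = (- a, - b)"
fun golden_double :: "golden_int \<Rightarrow> golden_int" where "golden_double (a, b) = (2 * a, 2 * b)"
fun golden_half :: "golden_int \<Rightarrow> golden_int" where "golden_half (a, b) = (a div 2, b div 2)"
fun golden_mult :: "golden_int \<Rightarrow> golden_int \<Rightarrow> golden_int" where
  "golden_mult (a, b) (c, d) = (a * c + b * d, a * d + b * c + b * d)"

fun ico_cnj :: "icosian \<Rightarrow> icosian" where
  "ico_cnj (a, b, c, d) = (a, golden_neg b, golden_neg c, golden_neg d)"
fun ico_double :: "icosian \<Rightarrow> icosian" where
  "ico_double (a, b, c, d) = (golden_double a, golden_double b, golden_double c, golden_double d)"
fun ico_half :: "icosian \<Rightarrow> icosian" where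
  "ico_half (a, b, c, d) = (golden_half a, golden_half b, golden_half c, golden_half d)"

text \<open>Multiplying the coordinates of quadruples that represent \<open>p\<close> and \<open>q\<close> gives a quadruple
  that represents \<open>2 p q\<close> (\<open>quat_of_ico_mult2\<close>). This avoids denominators; a product is verified
  by comparing with the double of the expected result.\<close>

fun ico_mult2 :: "icosian \<Rightarrow> icosian \<Rightarrow> icosian" where
  "ico_mult2 (a, b, c, d) (e, f, g, h) =
     (golden_sub (golden_sub (golden_mult a e) (golden_mult b f))
        (golden_add (golden_mult c g) (golden_mult d h)),
      golden_add (golden_add (golden_mult a f) (golden_mult b e))
        (golden_sub (golden_mult c h) (golden_mult d g)),
      golden_add (golden_add (golden_mult a g) (golden_mult c e))
        (golden_sub (golden_mult d f) (golden_mult b h)),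
      golden_add (golden_add (golden_mult a h) (golden_mult d e))
        (golden_sub (golden_mult b g) (golden_mult c f)))"

text \<open>The halved product represents \<open>p q\<close> only if all its coefficients are even, which is
  checked wherever it is used.\<close>

definition ico_mult :: "icosian \<Rightarrow> icosian \<Rightarrow> icosian" where
  "ico_mult p q = ico_half (ico_mult2 p q)"

text \<open>This represents \<open>4 g p g\<^sup>-\<^sup>1\<close> if \<open>g\<close> represents a unit quaternion.\<close>

definition ico_conj4 :: "icosian \<Rightarrow> icosian \<Rightarrow> icosian" where
  "ico_conj4 g p = ico_mult2 (ico_mult2 g p) (ico_cnj g)"

lemma golden_val_hom:
  "golden_val (golden_add a b) = golden_val a + golden_val b"
  "golden_val (golden_sub a b) = golden_val a - golden_val b"
  "golden_val (golden_neg a) = - golden_val a" "golden_val (golden_double a) = 2 * golden_val a"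
  by (cases a; cases b; simp add: algebra_simps)+

lemma golden_val_golden_mult: "golden_val (golden_mult a b) = golden_val a * golden_val b"
proof -
  have "golden_val (golden_mult (k, l) (m, n)) =
      of_int k * of_int m + (of_int k * of_int n + of_int l * of_int m) * golden
      + of_int l * of_int n * (golden * golden)" for k l m n
    by (simp add: golden_square algebra_simps)
  then show ?thesis by (cases a; cases b) (simp add: algebra_simps)
qed

lemma golden_val_eq_iff: "golden_val a = golden_val b \<longleftrightarrow> a = b"
proof
  assume "golden_val a = golden_val b"
  then have "of_int (fst a - fst b) + of_int (snd a - snd b) * golden = 0"
    by (cases a; cases b) (simp add: algebra_simps)
  from int_golden_eq_0[OF this] show "a = b" by (simp add: prod_eq_iff)
qed simp

lemma fst_quat_of: "fst (quat_of z) = golden_val (fst z) / 2"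
  by (cases z rule: prod_cases4) simp

lemma quat_of_eq_iff: "quat_of z = quat_of w \<longleftrightarrow> z = w"
  by (cases z rule: prod_cases4; cases w rule: prod_cases4)
    (simp add: vec_eq_iff forall_3 golden_val_eq_iff del: golden_val.simps)

lemma inj_on_quat_of: "inj_on quat_of A"
  by (simp add: inj_on_def quat_of_eq_iff)

lemma snd_quat_of_eq_0_iff: "snd (quat_of z) = 0 \<longleftrightarrow> snd z = ((0, 0), (0, 0), (0, 0))"
proof -
  have "golden_val a / 2 = 0 \<longleftrightarrow> a = (0, 0)" for a
    using golden_val_eq_iff[of a "(0, 0)"] by simp
  then show ?thesis
    by (cases z rule: prod_cases4) (simp add: vec_eq_iff forall_3 del: golden_val.simps)
qed

lemma quat_of_ico_mult2: "quat_of (ico_mult2 p q) = 2 *\<^sub>R qmult (quat_of p) (quat_of q)"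
  by (cases p rule: prod_cases4; cases q rule: prod_cases4; hypsubst)
    (simp add: quat_simps golden_val_hom golden_val_golden_mult field_simps del: golden_val.simps)

lemma quat_of_ico_double: "quat_of (ico_double p) = 2 *\<^sub>R quat_of p"
  by (cases p rule: prod_cases4)
    (simp add: vec_eq_iff forall_3 golden_val_hom del: golden_val.simps)

lemma quat_of_ico_cnj: "quat_of (ico_cnj p) = qcnj (quat_of p)"
  by (cases p rule: prod_cases4)
    (simp add: qcnj_def vec_eq_iff forall_3 golden_val_hom del: golden_val.simps)

lemma quat_of_product: "ico_mult2 p q = ico_double r \<Longrightarrow> qmult (quat_of p) (quat_of q) = quat_of r"
  using quat_of_ico_mult2[of p q] by (simp add: quat_of_ico_double)

lemma quat_of_conjugate:
  assumes "ico_conj4 g p = ico_double (ico_double r)"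
  shows "qmult (qmult (quat_of g) (quat_of p)) (qcnj (quat_of g)) = quat_of r"
proof -
  have scale: "qmult (2 *\<^sub>R u) v = 2 *\<^sub>R qmult u v" for u v
    by (simp add: quat_simps algebra_simps)
  have "4 *\<^sub>R qmult (qmult (quat_of g) (quat_of p)) (qcnj (quat_of g)) = quat_of (ico_conj4 g p)"
    unfolding ico_conj4_def quat_of_ico_mult2 scale by (simp add: quat_of_ico_cnj)
  also have "\<dots> = 4 *\<^sub>R quat_of r" by (simp add: assms quat_of_ico_double)
  finally show ?thesis by (simp del: scaleR_Pair)
qed

lemma quat_of_S3: "ico_mult2 g (ico_cnj g) = ico_double ((2, 0), (0, 0), (0, 0), (0, 0)) \<Longrightarrow>
    quat_of g \<in> S3"
  using quat_of_product[of g "ico_cnj g" "((2, 0), (0, 0), (0, 0), (0, 0))"]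
  by (simp add: S3_iff quat_of_ico_cnj qmult_def qcnj_def)

section \<open>The 120 elements of the binary dodecahedral group\<close>

text \<open>The unit quaternions \<open>1\<close>, \<open>i\<close>, \<open>k\<close>, \<open>(1 + i + j + k) / 2\<close>, \<open>q\<close> and \<open>q'\<close>.\<close>

definition ico_1 :: icosian where "ico_1 = ((2, 0), (0, 0), (0, 0), (0, 0))"
definition ico_i :: icosian where "ico_i = ((0, 0), (2, 0), (0, 0), (0, 0))"
definition ico_k :: icosian where "ico_k = ((0, 0), (0, 0), (0, 0), (2, 0))"
definition ico_r :: icosian where "ico_r = ((1, 0), (1, 0), (1, 0), (1, 0))"
definition ico_q :: icosian where "ico_q = ((0, 1), (1, 0), (-1, 1), (0, 0))"
definition ico_q' :: icosian where "ico_q' = ((0, 1), (0, 0), (1, 0), (-1, 1))"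

lemma quat_of_ico_1: "quat_of ico_1 = qone"
  by (simp add: ico_1_def qone_def vec_eq_iff forall_3)

lemma quat_of_ico_q: "quat_of ico_q = gen_q"
  by (simp add: ico_q_def gen_q_def cos_pi_fifth sin_dod_x sin_dod_y vec_eq_iff forall_3)

lemma quat_of_ico_q': "quat_of ico_q' = gen_q'"
  by (simp add: ico_q'_def gen_q'_def cos_pi_fifth sin_dod_x sin_dod_y vec_eq_iff forall_3)

text \<open>The vectors \<open>(\<phi> i + j) / 2\<close> and so on. By \<open>x = \<phi> y\<close>, the face directions are their
  multiples by \<open>2 y\<close>. The vectors at positions 0 and 4 have the directions of \<open>f\<close> and \<open>f'\<close>.\<close>

definition ico_dirs :: "icosian list" where
  "ico_dirs = [((0, 0), (0, 1), (1, 0), (0, 0)), ((0, 0), (0, 1), (-1, 0), (0, 0)),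
    ((0, 0), (0, -1), (1, 0), (0, 0)), ((0, 0), (0, -1), (-1, 0), (0, 0)),
    ((0, 0), (0, 0), (0, 1), (1, 0)), ((0, 0), (0, 0), (0, 1), (-1, 0)),
    ((0, 0), (0, 0), (0, -1), (1, 0)), ((0, 0), (0, 0), (0, -1), (-1, 0)),
    ((0, 0), (1, 0), (0, 0), (0, 1)), ((0, 0), (1, 0), (0, 0), (0, -1)),
    ((0, 0), (-1, 0), (0, 0), (0, 1)), ((0, 0), (-1, 0), (0, 0), (0, -1))]"

definition ico_dir_vec :: "icosian \<Rightarrow> real ^ 3" where
  "ico_dir_vec z = (2 * dod_y) *\<^sub>R snd (quat_of z)"

lemma face_directions_ico_dirs: "face_directions = ico_dir_vec ` set ico_dirs"
proof -
  have "ico_dir_vec ((0, 0), b, c, d) =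
      vector [dod_y * golden_val b, dod_y * golden_val c, dod_y * golden_val d]" for b c d
    by (simp add: ico_dir_vec_def vec_eq_iff forall_3 del: golden_val.simps)
  then show ?thesis
    by (simp add: ico_dirs_def face_directions_eq dod_x_eq_golden mult.commute del: quat_of.simps)
qed

lemma ico_dirs_pure: "z \<in> set ico_dirs \<Longrightarrow> fst (quat_of z) = 0"
  by (auto simp: ico_dirs_def)

lemma icosian_bin_dod:
  assumes "ico_mult2 g (ico_cnj g) = ico_double ((2, 0), (0, 0), (0, 0), (0, 0))"
    and "list_all (\<lambda>z. ico_conj4 g z \<in> set (map (\<lambda>w. ico_double (ico_double w)) ico_dirs)) ico_dirs"
  shows "quat_of g \<in> bin_dod"
proof -
  have S: "quat_of g \<in> S3" using assms(1) by (rule quat_of_S3)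
  have "psi (quat_of g) (ico_dir_vec z) \<in> face_directions" if z: "z \<in> set ico_dirs" for z
  proof -
    obtain w where w: "w \<in> set ico_dirs" "ico_conj4 g z = ico_double (ico_double w)"
      using assms(2) z by (auto simp: list_all_iff)
    have "(0, snd (quat_of z)) = quat_of z" using ico_dirs_pure[OF z] by (simp add: prod_eq_iff)
    then have "(0, psi (quat_of g) (snd (quat_of z))) = quat_of w"
      using psi_quat[OF S, of "snd (quat_of z)"] quat_of_conjugate[OF w(2)] by simp
    then have "psi (quat_of g) (snd (quat_of z)) = snd (quat_of w)" by (metis snd_conv)
    moreover have "linear (psi (quat_of g))"
      using S by (simp add: orthogonal_transformation_psi orthogonal_transformation_linear)
    ultimately have "psi (quat_of g) (ico_dir_vec z) = ico_dir_vec w"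
      by (simp add: ico_dir_vec_def linear_cmul)
    then show ?thesis using w(1) face_directions_ico_dirs by blast
  qed
  then show ?thesis using S by (auto simp: bin_dod_iff face_directions_ico_dirs)
qed

lemma generators_bin_dod: "gen_q \<in> bin_dod" "gen_q' \<in> bin_dod" "quat_of ico_k \<in> bin_dod"
proof -
  have "quat_of ico_q \<in> bin_dod" by (rule icosian_bin_dod) code_simp+
  then show "gen_q \<in> bin_dod" by (simp add: quat_of_ico_q)
  have "quat_of ico_q' \<in> bin_dod" by (rule icosian_bin_dod) code_simp+
  then show "gen_q' \<in> bin_dod" by (simp add: quat_of_ico_q')
  show "quat_of ico_k \<in> bin_dod" by (rule icosian_bin_dod) code_simp+
qed

fun q_power :: "nat \<Rightarrow> icosian" where
  "q_power 0 = ico_1"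
| "q_power (Suc n) = ico_mult (q_power n) ico_q"

text \<open>The powers of \<open>q\<close>, which has order ten.\<close>

definition spinal_list :: "icosian list" where
  "spinal_list = map q_power [0..<10]"

text \<open>Representatives of the right cosets of the spinal ring: \<open>1\<close> for the spinal ring itself,
  \<open>k\<close> for the equatorial ring, \<open>q' q\<^sup>-\<^sup>i\<close> for the inner rings and \<open>k q' q\<^sup>-\<^sup>i\<close> for the outer
  rings. The quaternion \<open>k\<close> is orthogonal to \<open>1\<close> and \<open>f\<close> and normalises the spinal ring, so left
  multiplication by \<open>k\<close> permutes the rings.\<close>

definition coset_reps :: "icosian list" where
  "coset_reps = [ico_1, ico_k] @ map (\<lambda>n. ico_mult ico_q' (ico_cnj (q_power n))) [0..<5]
     @ map (\<lambda>n. ico_mult ico_k (ico_mult ico_q' (ico_cnj (q_power n)))) [0..<5]"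

text \<open>The right coset of the spinal ring with the representative number \<open>j\<close>.\<close>

definition ring_list :: "nat \<Rightarrow> icosian list" where
  "ring_list j = map (\<lambda>g. ico_mult g (coset_reps ! j)) spinal_list"

text \<open>The elements of the binary dodecahedral group, ring by ring.\<close>

definition icosians :: "icosian list" where
  "icosians = concat (map ring_list [0..<12])"

lemma quat_of_q_power_Suc: "n < 10 \<Longrightarrow> quat_of (q_power (Suc n)) = qmult (quat_of (q_power n)) gen_q"
proof -
  have "list_all (\<lambda>n. ico_mult2 (q_power n) ico_q = ico_double (q_power (Suc n))) [0..<10]"
    by code_simp
  then show "n < 10 \<Longrightarrow> ?thesis"
    using quat_of_product[of "q_power n" ico_q "q_power (Suc n)"]
      by (simp add: list_all_iff quat_of_ico_q)
qed

lemma q_power_bin_dod: "n < 10 \<Longrightarrow> quat_of (q_power n) \<in> bin_dod"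
  by (induction n)
    (simp_all add: quat_of_ico_1 qone_bin_dod quat_of_q_power_Suc qmult_bin_dod
      generators_bin_dod del: q_power.simps(2))

lemma quat_of_inner_rep:
  "n < 5 \<Longrightarrow> quat_of (ico_mult ico_q' (ico_cnj (q_power n))) =
      qmult gen_q' (qcnj (quat_of (q_power n)))"
proof -
  have "list_all (\<lambda>n. ico_mult2 ico_q' (ico_cnj (q_power n)) =
      ico_double (ico_mult ico_q' (ico_cnj (q_power n)))) [0..<5]"
    by code_simp
  then show "n < 5 \<Longrightarrow> ?thesis"
    using quat_of_product[of ico_q' "ico_cnj (q_power n)"]
      by (simp add: list_all_iff quat_of_ico_q' quat_of_ico_cnj)
qed

lemma quat_of_outer_rep:
  "n < 5 \<Longrightarrow> quat_of (ico_mult ico_k (ico_mult ico_q' (ico_cnj (q_power n)))) =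
     qmult (quat_of ico_k) (quat_of (ico_mult ico_q' (ico_cnj (q_power n))))"
proof -
  have "list_all (\<lambda>n. ico_mult2 ico_k (ico_mult ico_q' (ico_cnj (q_power n))) =
      ico_double (ico_mult ico_k (ico_mult ico_q' (ico_cnj (q_power n))))) [0..<5]"
    by code_simp
  then show "n < 5 \<Longrightarrow> ?thesis"
    using quat_of_product[of ico_k "ico_mult ico_q' (ico_cnj (q_power n))"]
      by (simp add: list_all_iff)
qed

lemma coset_reps_bin_dod: "p \<in> set coset_reps \<Longrightarrow> quat_of p \<in> bin_dod"
  by (auto simp: coset_reps_def quat_of_ico_1 qone_bin_dod generators_bin_dod quat_of_inner_rep
      quat_of_outer_rep
      intro!: qmult_bin_dod qcnj_bin_dod q_power_bin_dod)

lemma length_coset_reps: "length coset_reps = 12"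
  by (simp add: coset_reps_def)

lemma quat_of_ring_list:
  "g \<in> set spinal_list \<Longrightarrow> j < 12 \<Longrightarrow>
     quat_of (ico_mult g (coset_reps ! j)) = qmult (quat_of g) (quat_of (coset_reps ! j))"
proof -
  have "list_all (\<lambda>p. list_all (\<lambda>g. ico_mult2 g p =
      ico_double (ico_mult g p)) spinal_list) coset_reps" by code_simp
  then show "g \<in> set spinal_list \<Longrightarrow> j < 12 \<Longrightarrow> ?thesis"
    using quat_of_product[of g "coset_reps ! j"] by (simp add: list_all_iff length_coset_reps)
qed

lemma icosians_bin_dod: "z \<in> set icosians \<Longrightarrow> quat_of z \<in> bin_dod"
proof -
  assume "z \<in> set icosians"
  then obtain g j where g: "g \<in> set spinal_list" and j: "j < 12" and z: "z =
      ico_mult g (coset_reps ! j)"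
    by (auto simp: icosians_def ring_list_def)
  have "quat_of g \<in> bin_dod" using g q_power_bin_dod by (auto simp: spinal_list_def)
  moreover have "quat_of (coset_reps ! j) \<in> bin_dod" using j coset_reps_bin_dod
    by (simp add: length_coset_reps)
  ultimately show ?thesis using g j z by (simp add: quat_of_ring_list qmult_bin_dod)
qed

lemma distinct_icosians: "distinct icosians"
  by code_simp

lemma length_icosians: "length icosians = 120"
  by code_simp

text \<open>The images of two linearly independent vectors determine a rotation, and hence the unit
  quaternion up to sign.\<close>

lemma psi_determines:
  assumes p: "p \<in> S3" and q: "q \<in> S3" and f: "cross3 f f' \<noteq> 0"
    and eq: "psi p f = psi q f" "psi p f' = psi q f'"
  shows "q = p \<or> q = - p"
proof -
  define r where "r = qmult (qcnj p) q"
  have r: "r \<in> S3" unfolding r_def using p q by (simp add: qmult_S3 qcnj_S3)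
  have "psi r v = psi (qcnj p) (psi q v)" for v
    unfolding r_def using p q by (simp add: psi_mult qcnj_S3)
  then have "psi r f = f" "psi r f' = f'"
    using eq psi_qcnj[OF p] by metis+
  then have c: "cross3 (snd r) f = 0" "cross3 (snd r) f' = 0"
    using psi_fixed_iff[OF r] by auto
  have "snd r = 0"
  proof (rule ccontr)
    assume u: "snd r \<noteq> 0"
    obtain s s' where "f = s *\<^sub>R snd r" "f' = s' *\<^sub>R snd r"
      using axis_multiple[OF u c(1)] axis_multiple[OF u c(2)] by blast
    then show False using f by (simp add: cross_mult_left cross_mult_right)
  qed
  moreover have "fst r * fst r = 1" using r \<open>snd r = 0\<close> by (simp add: S3_iff)
  then have "fst r = 1 \<or> fst r = - 1" by algebra
  ultimately have "r = qone \<or> r = - qone" by (auto simp: qone_def prod_eq_iff)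
  moreover have "qmult p r = q"
    unfolding r_def using qmult_qcnj[OF p] by (simp flip: qmult_assoc)
  ultimately show ?thesis by (auto simp: qmult_uminus_right)
qed

text \<open>Pairs of directions of adjacent faces, recognised by their inner product.\<close>

definition ico_flags :: "(icosian \<times> icosian) list" where
  "ico_flags = [(z, w). z \<leftarrow> ico_dirs, w \<leftarrow> ico_dirs,
     fst (ico_mult2 z w) = fst (ico_mult2 (ico_dirs ! 0) (ico_dirs ! 4))]"

lemma length_ico_flags: "length ico_flags = 60"
  by code_simp

lemma inner_ico_dir_vec:
  assumes "z \<in> set ico_dirs" "w \<in> set ico_dirs"
  shows "ico_dir_vec z \<bullet> ico_dir_vec w = - (dod_y * dod_y * golden_val (fst (ico_mult2 z w)))"
proof -
  have "golden_val (fst (ico_mult2 z w)) = 2 * fst (quat_of (ico_mult2 z w))"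
    by (simp add: fst_quat_of)
  also have "\<dots> = - 4 * (snd (quat_of z) \<bullet> snd (quat_of w))"
    using ico_dirs_pure assms by (simp add: quat_of_ico_mult2 qmult_def)
  finally show ?thesis by (simp add: ico_dir_vec_def)
qed

text \<open>The images of \<open>f\<close> and \<open>f'\<close> under an element of the group are one of 60 pairs of adjacent
  face directions, and each pair is attained by at most two elements.\<close>

lemma finite_card_bin_dod: "finite bin_dod \<and> card bin_dod \<le> 120"
proof -
  let ?f = "ico_dir_vec (ico_dirs ! 0)" and ?f' = "ico_dir_vec (ico_dirs ! 4)"
  define fiber where "fiber = (\<lambda>(z, w). {q \<in> bin_dod. psi q ?f = ico_dir_vec z \<and> psi q ?f' =
      ico_dir_vec w})"
  have mem: "ico_dirs ! 0 \<in> set ico_dirs" "ico_dirs ! 4 \<in> set ico_dirs"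
    by (simp_all add: ico_dirs_def)
  have cross: "cross3 ?f ?f' \<noteq> 0"
    using dod_y_pos by (simp add: ico_dirs_def ico_dir_vec_def cross3_def vec_eq_iff forall_3)
  have fiber: "finite (fiber x) \<and> card (fiber x) \<le> 2" for x
  proof (cases "fiber x = {}")
    case False
    then obtain p where p: "p \<in> fiber x" by blast
    have "fiber x \<subseteq> {p, - p}"
    proof
      fix q assume "q \<in> fiber x"
      then show "q \<in> {p, - p}"
        using p psi_determines[OF bin_dod_S3 bin_dod_S3 cross, of p q]
        by (auto simp: fiber_def split: prod.splits)
    qed
    moreover have "card {p, - p} \<le> 2" by (simp add: card_insert_if)
    ultimately show ?thesis
      by (meson card_mono finite.emptyI finite.insertI finite_subset order_trans)
  qed simp
  have sub: "bin_dod \<subseteq> (\<Union>x \<in> set ico_flags. fiber x)"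
  proof
    fix q assume q: "q \<in> bin_dod"
    then have "psi q ?f \<in> face_directions" "psi q ?f' \<in> face_directions"
      using mem by (auto simp: bin_dod_iff face_directions_ico_dirs)
    then obtain z w where z: "z \<in> set ico_dirs" "psi q ?f = ico_dir_vec z"
      and w: "w \<in> set ico_dirs" "psi q ?f' = ico_dir_vec w"
      by (auto simp: face_directions_ico_dirs)
    have "ico_dir_vec z \<bullet> ico_dir_vec w = ?f \<bullet> ?f'"
      using orthogonal_transformation_psi[OF bin_dod_S3[OF q]] z(2) w(2)
      by (metis orthogonal_transformation_def)
    then have "golden_val (fst (ico_mult2 z w)) =
        golden_val (fst (ico_mult2 (ico_dirs ! 0) (ico_dirs ! 4)))"
      unfolding inner_ico_dir_vec[OF z(1) w(1)] inner_ico_dir_vec[OF mem] using dod_y_pos by simp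
    then have "(z, w) \<in> set ico_flags"
      using z(1) w(1) by (auto simp: ico_flags_def golden_val_eq_iff)
    moreover have "q \<in> fiber (z, w)" using q z w by (simp add: fiber_def)
    ultimately show "q \<in> (\<Union>x \<in> set ico_flags. fiber x)" by blast
  qed
  have fin: "finite (\<Union>x \<in> set ico_flags. fiber x)" using fiber by blast
  have "card bin_dod \<le> card (\<Union>x \<in> set ico_flags. fiber x)" using sub fin
    by (rule card_mono[rotated])
  also have "\<dots> \<le> (\<Sum>x \<in> set ico_flags. card (fiber x))" by (rule card_UN_le) simp
  also have "\<dots> \<le> (\<Sum>x \<in> set ico_flags. 2)" using fiber by (intro sum_mono) blast
  also have "\<dots> \<le> 120" using card_length[of ico_flags] by (simp add: length_ico_flags)
  finally show ?thesis using sub fin finite_subset by blast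
qed

theorem bin_dod_eq: "bin_dod = quat_of ` set icosians"
proof (rule card_seteq[symmetric])
  show "finite bin_dod" "card bin_dod \<le> card (quat_of ` set icosians)"
    using finite_card_bin_dod
    by (simp_all add: card_image inj_on_quat_of distinct_card distinct_icosians length_icosians)
qed (use icosians_bin_dod in blast)

section \<open>The layers\<close>

lemma cross3_commuting: "qmult p q = qmult q p \<Longrightarrow> cross3 (snd p) (snd q) = 0"
  by (auto simp: quat_simps mult.commute)

text \<open>Commuting quaternions have parallel imaginary parts, so the axis of the rotation by \<open>z\<close> is
  the line spanned by the imaginary part of \<open>a\<close>.\<close>

lemma rotation_type_axis:
  assumes p: "quat_of z \<in> S3" "snd z \<noteq> ((0, 0), (0, 0), (0, 0))"
    and comm: "ico_mult2 z a = ico_mult2 a z"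
    and w: "c *\<^sub>R snd (quat_of a) \<in> class_points T"
  shows "has_rotation_type (psi (quat_of z)) T"
proof -
  have "qmult (quat_of z) (quat_of a) = qmult (quat_of a) (quat_of z)"
    using comm quat_of_ico_mult2[of z a] quat_of_ico_mult2[of a z] by simp
  then have "cross3 (snd (quat_of z)) (c *\<^sub>R snd (quat_of a)) = 0"
    by (simp add: cross3_commuting cross_mult_right)
  then have "psi (quat_of z) (c *\<^sub>R snd (quat_of a)) = c *\<^sub>R snd (quat_of a)"
    by (simp add: psi_fixed_iff[OF p(1)])
  moreover have "psi (quat_of z) \<noteq> id" using p by (simp add: psi_eq_id_iff snd_quat_of_eq_0_iff)
  moreover have "T \<noteq> Identity" using w by auto
  ultimately show ?thesis using w by (auto simp: has_rotation_type_iff)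
qed

lemma class_point_ico_q: "\<exists>c. c *\<^sub>R snd (quat_of ico_q) \<in> class_points Face"
proof -
  define f where "f = (vector [dod_x, dod_y, 0] :: real ^ 3)"
  have s: "snd gen_q = sin (pi / 5) *\<^sub>R f" by (simp add: gen_q_def f_def)
  have "snd gen_q \<noteq> 0" using snd_quat_of_eq_0_iff[of ico_q] unfolding quat_of_ico_q
    by (simp add: ico_q_def)
  moreover have "f \<in> face_directions" by (simp add: f_def face_directions_eq)
  moreover have "cross3 (snd gen_q) f = 0" by (simp add: s cross_mult_left)
  ultimately have "inradius *\<^sub>R f \<in> dod_face_centres"
    using generators_bin_dod(1) by (intro face_centre)
  moreover have "inradius *\<^sub>R f = (inradius / sin (pi / 5)) *\<^sub>R snd (quat_of ico_q)"
    using sin_pi_fifth_pos by (simp add: quat_of_ico_q s)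
  ultimately show ?thesis by (metis class_points.simps(2))
qed

lemma class_point_ico_r: "\<exists>c. c *\<^sub>R snd (quat_of ico_r) \<in> class_points Vertex"
proof -
  have "(1 / sqrt 3) *\<^sub>R vector [1, 1, 1] = (2 / sqrt 3) *\<^sub>R snd (quat_of ico_r)"
    by (simp add: ico_r_def vec_eq_iff forall_3)
  then show ?thesis using vertex_111 by (metis class_points.simps(3))
qed

lemma class_point_ico_i: "\<exists>c. c *\<^sub>R snd (quat_of ico_i) \<in> class_points Edge"
proof -
  have "(inradius / dod_x) *\<^sub>R vector [1, 0, 0] = (inradius / dod_x) *\<^sub>R snd (quat_of ico_i)"
    by (simp add: ico_i_def vec_eq_iff forall_3)
  then show ?thesis using edge_midpoint_100 by (metis class_points.simps(4))
qed

text \<open>All elements of the list with the same real part as \<open>r\<close> are conjugates of \<open>r\<close>. The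
  conjugating elements are the inverses of \<open>q\<^sup>m p\<close> for coset representatives \<open>p\<close> and \<open>m < n\<close>.
  With \<open>n = 1\<close> this is enough if \<open>r\<close> is a power of \<open>q\<close>, and \<open>n = 5\<close> is always enough since
  \<open>q\<^sup>5 = - 1\<close>.\<close>

definition layer_conjugate :: "nat \<Rightarrow> icosian \<Rightarrow> bool" where
  "layer_conjugate n r \<longleftrightarrow>
     set (map (\<lambda>z. ico_double (ico_double z)) (filter (\<lambda>z. fst z = fst r) icosians))
       \<subseteq> set (map (\<lambda>g. ico_conj4 (ico_cnj g) r)
         [ico_mult g p. p \<leftarrow> coset_reps, g \<leftarrow> take n spinal_list])"

lemma layer_conjugates:
  "layer_conjugate 1 ico_1" "layer_conjugate 1 (q_power 1)" "layer_conjugate 1 (q_power 2)"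
  "layer_conjugate 1 (q_power 3)" "layer_conjugate 1 (q_power 4)" "layer_conjugate 1 (q_power 5)"
  by code_simp+

lemma layer_conjugate_ico_r: "layer_conjugate 5 ico_r" by code_simp

lemma layer_conjugate_ico_i: "layer_conjugate 5 ico_i" by code_simp

lemma layer_conjugate_ico_neg_r: "layer_conjugate 5 ((- 1, 0), (1, 0), (1, 0), (1, 0))" by code_simp

lemma rotation_type_layer:
  assumes "layer_conjugate n r" and r: "quat_of r \<in> S3" "has_rotation_type (psi (quat_of r)) T"
    and z: "z \<in> set icosians" "fst z = fst r"
  shows "has_rotation_type (psi (quat_of z)) T' \<longleftrightarrow> T' = T"
proof -
  have "ico_double (ico_double z) \<in> set (map (\<lambda>g. ico_conj4 (ico_cnj g) r)
      [ico_mult g p. p \<leftarrow> coset_reps, g \<leftarrow> take n spinal_list])"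
    using assms(1) z unfolding layer_conjugate_def by auto
  then obtain h p where p: "p \<in> set coset_reps" and h: "h \<in> set (take n spinal_list)"
    and conj: "ico_conj4 (ico_cnj (ico_mult h p)) r = ico_double (ico_double z)"
    by force
  obtain j where "j < 12" "p = coset_reps ! j" using p by (metis in_set_conv_nth length_coset_reps)
  moreover have "h \<in> set spinal_list" using h by (rule in_set_takeD)
  ultimately have g: "ico_mult h p \<in> set icosians"
    by (auto simp: icosians_def ring_list_def intro!: bexI[of _ j])
  have "quat_of (ico_cnj (ico_mult h p)) \<in> bin_dod"
    using g icosians_bin_dod qcnj_bin_dod quat_of_ico_cnj by simp
  from has_rotation_type_conjugate[OF this r]
  have "has_rotation_type (psi (quat_of z)) T" by (simp add: quat_of_conjugate[OF conj])
  then show ?thesis using rotation_type_unique icosians_bin_dod[OF z(1)] bin_dod_S3 by blast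
qed

section \<open>The rings\<close>

text \<open>The rings in the order of the coset representatives: 0 is the spinal ring, 1 the
  equatorial ring, 2 to 6 are the inner rings and 7 to 11 the outer rings.\<close>

abbreviation nth_ring :: "nat \<Rightarrow> quat set" where
  "nth_ring j \<equiv> quat_of ` set (ring_list j)"

lemma icosians_ring_list: "set icosians = (\<Union>j<12. set (ring_list j))"
  by (auto simp: icosians_def)

lemma ring_subset: "j < 12 \<Longrightarrow> nth_ring j \<subseteq> bin_dod"
  using icosians_ring_list by (auto simp: bin_dod_eq)

lemma inv_bin_dod_group: "p \<in> bin_dod \<Longrightarrow> inv\<^bsub>bin_dod_group\<^esub> p = qcnj p"
  using qmult_qcnj[OF bin_dod_S3, of p] qcnj_bin_dod[of p]
  by (intro group.inv_equality[OF group_bin_dod]) (auto simp: bin_dod_group_def)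

lemma spinal_ring_eq: "spinal_ring = quat_of ` set spinal_list"
proof
  have closed: "list_all (\<lambda>g. ico_cnj g \<in> set spinal_list \<and>
      list_all (\<lambda>h. ico_mult2 g h \<in> set (map ico_double spinal_list)) spinal_list) spinal_list" by code_simp
  have q: "gen_q \<in> quat_of ` set spinal_list"
  proof -
    have "ico_q \<in> set spinal_list" by code_simp
    then show ?thesis by (metis quat_of_ico_q imageI)
  qed
  have "p \<in> quat_of ` set spinal_list" if "p \<in> spinal_ring" for p
    using that unfolding spinal_ring_def
  proof (induction rule: generate.induct)
    case one
    have "ico_1 \<in> set spinal_list" by code_simp
    then show ?case by (metis quat_of_ico_1 imageI bin_dod_group_def monoid.select_convs(2))
  next
    case (incl h)
    then show ?case using q by simp
  next
    case (inv h)
    then show ?case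
    proof -
      obtain z where z: "z \<in> set spinal_list" "gen_q = quat_of z" using q by blast
      then have "qcnj gen_q = quat_of (ico_cnj z)" by (simp add: quat_of_ico_cnj)
      moreover have "ico_cnj z \<in> set spinal_list" using closed z(1) by (auto simp: list_all_iff)
      ultimately show ?thesis using inv by (simp add: inv_bin_dod_group generators_bin_dod)
    qed
  next
    case (eng g h)
    then obtain a b where ab: "a \<in> set spinal_list" "b \<in> set spinal_list" "g = quat_of a"
      "h = quat_of b" by blast
    then obtain c where "c \<in> set spinal_list" "ico_mult2 a b = ico_double c"
      using closed by (force simp: list_all_iff)
    then show ?case using quat_of_product ab by (auto simp: bin_dod_group_def)
  qed
  then show "spinal_ring \<subseteq> quat_of ` set spinal_list" by blast
  have "quat_of (q_power n) \<in> spinal_ring" if "n < 10" for n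
    using that
  proof (induction n)
    case 0
    have "\<one>\<^bsub>bin_dod_group\<^esub> \<in> spinal_ring" unfolding spinal_ring_def by (rule generate.one)
    then show ?case by (simp add: quat_of_ico_1 bin_dod_group_def)
  next
    case (Suc n)
    then have "quat_of (q_power n) \<in> generate bin_dod_group {gen_q}" by (simp add: spinal_ring_def)
    then have "quat_of (q_power n) \<otimes>\<^bsub>bin_dod_group\<^esub> gen_q \<in> spinal_ring"
      unfolding spinal_ring_def by (rule generate.eng[OF _ generate.incl]) simp
    then show ?case using Suc.prems quat_of_q_power_Suc[of n] by (simp add: bin_dod_group_def)
  qed
  then show "quat_of ` set spinal_list \<subseteq> spinal_ring" by (auto simp: spinal_list_def)
qed

lemma subgroup_spinal_ring: "subgroup spinal_ring bin_dod_group"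
  unfolding spinal_ring_def using generators_bin_dod
  by (intro group.generate_is_subgroup[OF group_bin_dod]) (auto simp: bin_dod_group_def)

lemma ring_eq_coset: "j < 12 \<Longrightarrow> nth_ring j = spinal_ring #>\<^bsub>bin_dod_group\<^esub> quat_of (coset_reps ! j)"
  by (auto simp: spinal_ring_eq r_coset_def bin_dod_group_def ring_list_def image_image quat_of_ring_list)

lemma spinal_ring_eq_ring: "spinal_ring = nth_ring 0"
proof -
  have "ring_list 0 = spinal_list" by code_simp
  then show ?thesis by (simp add: spinal_ring_eq)
qed

lemma rings_eq: "rings = nth_ring ` {..<12}"
proof -
  have *: "spinal_ring #>\<^bsub>bin_dod_group\<^esub> a = nth_ring j" if "j < 12" "a \<in> nth_ring j" for a j
  proof -
    have "quat_of (coset_reps ! j) \<in> carrier bin_dod_group"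
      using coset_reps_bin_dod that(1) by (simp add: bin_dod_group_def length_coset_reps)
    then show ?thesis
      using group.repr_independence[OF group_bin_dod _ _ subgroup_spinal_ring, of a "quat_of (coset_reps ! j)"]
        that by (simp add: ring_eq_coset)
  qed
  show ?thesis
  proof (intro equalityI subsetI)
    fix C assume "C \<in> rings"
    then obtain a where a: "a \<in> bin_dod" "C = spinal_ring #>\<^bsub>bin_dod_group\<^esub> a"
      by (auto simp: rings_def RCOSETS_def bin_dod_group_def)
    then obtain j where "j < 12" "a \<in> nth_ring j" by (auto simp: bin_dod_eq icosians_ring_list)
    then show "C \<in> nth_ring ` {..<12}" using * a(2) by blast
  next
    fix C assume "C \<in> nth_ring ` {..<12}"
    then obtain j where j: "j < 12" "C = spinal_ring #>\<^bsub>bin_dod_group\<^esub> quat_of (coset_reps ! j)"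
      using ring_eq_coset by auto
    have "quat_of (coset_reps ! j) \<in> carrier bin_dod_group"
      using coset_reps_bin_dod[OF nth_mem] j(1) by (simp add: bin_dod_group_def length_coset_reps)
    then show "C \<in> rings" using j(2) by (auto simp: rings_def RCOSETS_def)
  qed
qed

lemma nth_ring_inj: "inj_on nth_ring {..<12}"
proof (rule inj_onI)
  fix j k :: nat assume jk: "j \<in> {..<12}" "k \<in> {..<12}" and eq: "nth_ring j = nth_ring k"
  have ne: "ring_list i \<noteq> []" for i by (simp add: ring_list_def spinal_list_def)
  have d: "distinct (removeAll [] (map ring_list [0..<12]))"
    and disj: "\<And>xs ys. xs \<in> set (map ring_list [0..<12]) \<Longrightarrow> ys \<in> set (map ring_list [0..<12]) \<Longrightarrow>
        xs \<noteq> ys \<Longrightarrow>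
        set xs \<inter> set ys = {}"
    using distinct_icosians unfolding icosians_def distinct_concat_iff by blast+
  have "removeAll [] (map ring_list [0..<12]) = map ring_list [0..<12]"
    by (intro removeAll_id) (simp add: image_iff ne[symmetric])
  then have inj: "inj_on ring_list {0..<12}" using d by (simp add: distinct_map)
  have "set (ring_list j) = set (ring_list k)" using eq
    by (simp add: inj_image_eq_iff[OF inj_on_quat_of])
  then have "set (ring_list j) \<inter> set (ring_list k) \<noteq> {}" using ne by simp
  then have "ring_list j = ring_list k" using disj jk by fastforce
  then show "j = k" using inj jk by (auto dest: inj_onD)
qed

lemma dist_S_qone: "dist_S qone p = arccos (fst p)"
  by (simp add: dist_S_def qone_def inner_prod_def)

lemma fst_S3_le: "p \<in> S3 \<Longrightarrow> \<bar>fst p\<bar> \<le> 1"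
proof -
  assume "p \<in> S3"
  then have "fst p * fst p \<le> 1" by (simp add: S3_iff) (metis inner_ge_zero le_add_same_cancel1)
  then show ?thesis by (simp add: abs_square_le_1 flip: power2_eq_square)
qed

lemma dist_S_qone_eq_iff:
  assumes "p \<in> S3" "0 \<le> d" "d \<le> pi"
  shows "dist_S qone p = d \<longleftrightarrow> fst p = cos d"
  using fst_S3_le[OF assms(1)] assms(2,3) by (auto simp: dist_S_qone arccos_cos cos_arccos_abs)

lemma equatorial_ring_eq: "equatorial_ring = nth_ring 1"
proof -
  have eq: "list_all (\<lambda>j. list_all (\<lambda>z. fst z = (0, 0)) (ring_list j) \<longleftrightarrow> j = 1) [0..<12]"
    by code_simp
  have dist: "dist_S qone (quat_of z) = pi / 2 \<longleftrightarrow> fst z = (0, 0)" if "z \<in> set icosians" for z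
    using dist_S_qone_eq_iff[OF bin_dod_S3[OF icosians_bin_dod[OF that]], of "pi / 2"]
      golden_val_eq_iff[of "fst z" "(0, 0)"] by (simp add: fst_quat_of)
  have "(\<forall>p \<in> nth_ring j. dist_S qone p = pi / 2) \<longleftrightarrow> j = 1" if "j < 12" for j
  proof -
    have sub: "set (ring_list j) \<subseteq> set icosians" using that icosians_ring_list by blast
    have "(\<forall>p \<in> nth_ring j. dist_S qone p = pi / 2) \<longleftrightarrow>
        (\<forall>z \<in> set (ring_list j). dist_S qone (quat_of z) = pi / 2)"
      by blast
    also have "\<dots> \<longleftrightarrow> (\<forall>z \<in> set (ring_list j). fst z = (0, 0))"
      using sub by (intro ball_cong refl dist) blast
    finally have "(\<forall>p \<in> nth_ring j. dist_S qone p = pi / 2) \<longleftrightarrow> (\<forall>z \<in> set (ring_list j). fst z =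
        (0, 0))" .
    then show ?thesis using eq that by (auto simp: list_all_iff)
  qed
  then show ?thesis
    unfolding equatorial_ring_def rings_eq by (intro the_equality) auto
qed

lemma inner_ring_eq:
  assumes "i < 5"
  shows "inner_ring i = nth_ring (2 + i)"
proof -
  interpret group bin_dod_group by (rule group_bin_dod)
  have pow: "gen_q [^]\<^bsub>bin_dod_group\<^esub> n = quat_of (q_power n)" if "n < 10" for n :: nat
    using that
  proof (induction n)
    case 0
    show ?case by (simp add: quat_of_ico_1) (simp add: bin_dod_group_def)
  next
    case (Suc n)
    then show ?case using quat_of_q_power_Suc[of n]
      by (simp add: nat_pow_Suc) (simp add: bin_dod_group_def)
  qed
  have "gen_q \<in> carrier bin_dod_group" using generators_bin_dod by (simp add: bin_dod_group_def)
  then have "gen_q [^]\<^bsub>bin_dod_group\<^esub> (- int i) = qcnj (quat_of (q_power i))"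
    using assms pow[of i] by (simp add: int_pow_neg_int inv_bin_dod_group q_power_bin_dod)
  then have "gen_q' \<otimes>\<^bsub>bin_dod_group\<^esub> (gen_q [^]\<^bsub>bin_dod_group\<^esub> (- int i)) =
      quat_of (coset_reps ! (2 + i))"
    using assms quat_of_inner_rep[of i]
      by (simp add: coset_reps_def nth_append) (simp add: bin_dod_group_def)
  then show ?thesis using assms by (simp add: inner_ring_def ring_eq_coset)
qed

lemma outer_rings_eq: "outer_rings = nth_ring ` {7..<12}"
proof -
  have "inner_ring ` {0..4} = nth_ring ` {2..<7}"
  proof -
    have "inner_ring ` {0..4} = (\<lambda>i. nth_ring (2 + i)) ` {0..4}"
      by (rule image_cong) (auto simp: inner_ring_eq)
    also have "\<dots> = nth_ring ` ((\<lambda>i. 2 + i) ` {0..4})" by (simp only: image_image)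
    also have "(\<lambda>i. 2 + i) ` {0..4} = {2..<7::nat}" by (auto simp: image_iff) presburger
    finally show ?thesis .
  qed
  then have "outer_rings = nth_ring ` {..<12} - nth_ring ` {0, 1} - nth_ring ` {2..<7}"
    by (simp add: outer_rings_def rings_eq spinal_ring_eq_ring equatorial_ring_eq)
  also have "nth_ring ` {..<12} - nth_ring ` {0, 1} = nth_ring ` ({..<12} - {0, 1})"
    by (rule inj_on_image_set_diff[OF nth_ring_inj, symmetric]) auto
  also have "\<dots> - nth_ring ` {2..<7} = nth_ring ` ({..<12} - {0, 1} - {2..<7})"
    by (rule inj_on_image_set_diff[OF nth_ring_inj, symmetric]) auto
  also have "{..<12} - {0, 1} - {2..<7} = {7..<12::nat}" by auto
  finally show ?thesis .
qed

lemma card_outer_rings: "card outer_rings = 5"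
proof -
  have "inj_on nth_ring {7..<12}" using nth_ring_inj by (rule inj_on_subset) auto
  then show ?thesis by (simp add: outer_rings_eq card_image)
qed

section \<open>Counting cells\<close>

text \<open>A cell contains its centre, and no other centre, since that would be closer to itself.\<close>

lemma Vor_inj: "inj_on Vor bin_dod"
proof (rule inj_onI)
  fix p q assume p: "p \<in> bin_dod" and q: "q \<in> bin_dod" and eq: "Vor p = Vor q"
  have norm: "norm p = 1" "norm q = 1" using p q bin_dod_S3 by (auto simp: S3_def)
  have "dist_S p p = 0" using norm by (simp add: dist_S_def norm_eq_1)
  have abs: "\<bar>r \<bullet> p\<bar> \<le> 1" if "r \<in> bin_dod" for r
    using that bin_dod_S3 norm Cauchy_Schwarz_ineq2[of r p] by (auto simp: S3_def)
  have "p \<in> Vor p"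
    using p bin_dod_S3 \<open>dist_S p p = 0\<close> abs arccos_lbound
      by (auto simp: Vor_def dist_S_def abs_le_iff)
  then have "p \<in> Vor q" using eq by simp
  then have "dist_S q p \<le> dist_S p p" using p unfolding Vor_def by blast
  then have "dist_S q p \<le> 0" by (simp add: \<open>dist_S p p = 0\<close>)
  then have "arccos (q \<bullet> p) = 0"
    using abs[OF q] arccos_lbound[of "q \<bullet> p"] by (simp add: dist_S_def abs_le_iff)
  then have "q \<bullet> p = 1" using cos_arccos_abs[OF abs[OF q]] by simp
  then show "p = q" using norm norm_cauchy_schwarz_eq[of q p] by simp
qed

text \<open>The number of elements with real part \<open>a / 2\<close> in the ring with index \<open>j\<close>.\<close>

definition layer_count :: "golden_int \<Rightarrow> nat \<Rightarrow> nat" where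
  "layer_count a j = length (filter (\<lambda>z. fst z = a) (ring_list j))"

lemma layer_eq:
  assumes "0 \<le> d" "d \<le> pi" "cos d = golden_val a / 2"
  shows "layer d = (Vor \<circ> quat_of) ` {z \<in> set icosians. fst z = a}"
proof -
  have "dist_S qone (quat_of z) = d \<longleftrightarrow> fst z = a" if "z \<in> set icosians" for z
    using dist_S_qone_eq_iff[OF bin_dod_S3[OF icosians_bin_dod[OF that]] assms(1,2)]
    by (simp add: assms(3) fst_quat_of golden_val_eq_iff)
  then have "{p \<in> bin_dod. dist_S qone p = d} = quat_of ` {z \<in> set icosians. fst z = a}"
    unfolding bin_dod_eq by blast
  moreover have "layer d = Vor ` {p \<in> bin_dod. dist_S qone p = d}" by (auto simp: layer_def)
  ultimately show ?thesis by (simp add: image_comp)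
qed

lemma layer_row_counts:
  assumes d: "0 \<le> d" "d \<le> pi" "cos d = golden_val a / 2"
    and T: "\<And>z T'. z \<in> set icosians \<Longrightarrow> fst z = a \<Longrightarrow> has_rotation_type (psi (quat_of z)) T' \<longleftrightarrow> T' = T"
    and count: "map (layer_count a) [0..<12] = [s, e, i, i, i, i, i, u, u, u, u, u]"
  shows "layer_row d T (s + e + 5 * i + 5 * u) s e (5 * i + 5 * u) i u"
proof -
  define W where "W = Vor \<circ> quat_of"
  define L where "L = {z \<in> set icosians. fst z = a}"
  have injW: "inj_on W (set icosians)"
    unfolding W_def using Vor_inj by (intro comp_inj_on inj_on_quat_of) (simp add: bin_dod_eq)
  have dist: "distinct (ring_list j)" if "j < 12" for j
    using distinct_icosians that by (auto simp: icosians_def distinct_concat_iff)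
  have layer: "layer d = W ` L" unfolding W_def L_def by (rule layer_eq[OF d])
  have ring: "card (layer d \<inter> Vor ` nth_ring j) = layer_count a j" if "j < 12" for j
  proof -
    have sub: "L \<subseteq> set icosians" "set (ring_list j) \<subseteq> set icosians"
      using that icosians_ring_list by (auto simp: L_def)
    have "layer d \<inter> Vor ` nth_ring j = W ` (L \<inter> set (ring_list j))"
      unfolding layer inj_on_image_Int[OF injW sub] by (simp add: W_def image_comp)
    moreover have "inj_on W (L \<inter> set (ring_list j))" using injW sub by (auto intro: inj_on_subset)
    moreover have "L \<inter> set (ring_list j) = set (filter (\<lambda>z. fst z = a) (ring_list j))"
      using sub by (auto simp: L_def)
    ultimately have "card (layer d \<inter> Vor ` nth_ring j) = card (set (filter (\<lambda>z. fst z =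
        a) (ring_list j)))"
      by (metis card_image)
    also have "\<dots> = layer_count a j"
      unfolding layer_count_def by (rule distinct_card) (simp add: dist[OF that])
    finally show ?thesis .
  qed
  have counts: "layer_count a j = [s, e, i, i, i, i, i, u, u, u, u, u] ! j" if "j < 12" for j
    using arg_cong[OF count, of "\<lambda>xs. xs ! j"] that by simp
  have total: "card (layer d) = s + e + 5 * i + 5 * u"
  proof -
    have "L = set (filter (\<lambda>z. fst z = a) icosians)" by (auto simp: L_def)
    then have "card L = length (filter (\<lambda>z. fst z = a) icosians)"
      using distinct_icosians by (metis distinct_card distinct_filter)
    also have "\<dots> = sum_list (map (layer_count a) [0..<12])"
    proof -
      have "length (filter P (concat (map ring_list js))) =
          (\<Sum>j\<leftarrow>js. length (filter P (ring_list j)))" for P js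
        by (induction js) simp_all
      then show ?thesis by (simp only: icosians_def layer_count_def[abs_def])
    qed
    also have "\<dots> = s + e + 5 * i + 5 * u" unfolding count by simp
    finally show ?thesis
      unfolding layer using injW by (simp add: card_image inj_on_subset L_def)
  qed
  have spinal: "card (layer d \<inter> Vor ` spinal_ring) = s"
    using ring[of 0] counts[of 0] by (simp add: spinal_ring_eq_ring)
  have equatorial: "card (layer d \<inter> Vor ` equatorial_ring) = e"
    using ring[of 1] counts[of 1] by (simp add: equatorial_ring_eq)
  have "card (layer d - Vor ` spinal_ring - Vor ` equatorial_ring) = 5 * i + 5 * u"
  proof -
    have "finite (layer d)" by (simp add: layer L_def)
    have disj: "nth_ring 0 \<inter> nth_ring 1 = {}"
    proof -
      have "list_all (\<lambda>z. z \<notin> set (ring_list 1)) (ring_list 0)" by code_simp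
      then have "set (ring_list 0) \<inter> set (ring_list 1) = {}" unfolding list_all_iff by blast
      then show ?thesis by (simp only: image_Int[OF inj_on_quat_of, symmetric] image_empty)
    qed
    have "Vor ` spinal_ring \<inter> Vor ` equatorial_ring = {}"
      unfolding spinal_ring_eq_ring equatorial_ring_eq
      using inj_on_image_Int[OF Vor_inj, of "nth_ring 0" "nth_ring 1"] disj
        by (simp add: ring_subset)
    then have "layer d \<inter> Vor ` equatorial_ring =
        (layer d - Vor ` spinal_ring) \<inter> Vor ` equatorial_ring"
      by blast
    then have "card (layer d - Vor ` spinal_ring - Vor ` equatorial_ring) + e =
        card (layer d - Vor ` spinal_ring)"
      using card_Diff_subset_Int equatorial \<open>finite (layer d)\<close>
      by (metis card_Int_Diff add.commute finite_Diff)
    moreover have "card (layer d - Vor ` spinal_ring) + s = card (layer d)"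
      using card_Int_Diff[OF \<open>finite (layer d)\<close>, of "Vor ` spinal_ring"] spinal by simp
    ultimately show ?thesis using total by simp
  qed
  moreover have "card (layer d \<inter> Vor ` inner_ring k) = i" if "k \<in> {0..4}" for k
  proof -
    have "k < 5" using that by simp
    then have "k = 0 \<or> k = 1 \<or> k = 2 \<or> k = 3 \<or> k = 4" by linarith
    then have "[s, e, i, i, i, i, i, u, u, u, u, u] ! (2 + k) = i" by auto
    then show ?thesis using \<open>k < 5\<close> ring[of "2 + k"] counts[of "2 + k"] by (simp add: inner_ring_eq)
  qed
  moreover have "card (layer d \<inter> Vor ` C) = u" if C: "C \<in> outer_rings" for C
  proof -
    obtain k where k: "k \<in> {7..<12}" "C = nth_ring k" using C unfolding outer_rings_eq by blast
    then have "k = 7 \<or> k = 8 \<or> k = 9 \<or> k = 10 \<or> k = 11" by auto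
    then have "[s, e, i, i, i, i, i, u, u, u, u, u] ! k = u" by auto
    then show ?thesis using k ring[of k] counts[of k] by simp
  qed
  moreover have "has_rotation_type (psi p) T' \<longleftrightarrow> T' = T"
    if p: "p \<in> bin_dod" and dist_p: "dist_S qone p = d" for p T'
  proof -
    obtain z where z: "z \<in> set icosians" "p = quat_of z" using p unfolding bin_dod_eq by blast
    have "golden_val (fst z) = golden_val a"
      using dist_p dist_S_qone_eq_iff[OF bin_dod_S3[OF p] d(1,2)]
        by (simp add: z(2) d(3) fst_quat_of)
    then show ?thesis using T z by (simp add: golden_val_eq_iff)
  qed
  ultimately show ?thesis
    unfolding layer_row_def using total spinal equatorial by blast
qed

lemma layer_counts:
  "map (layer_count (2, 0)) [0..<12] = [1, 0, 0, 0, 0, 0, 0, 0, 0, 0, 0, 0]"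
  "map (layer_count (0, 1)) [0..<12] = [2, 0, 2, 2, 2, 2, 2, 0, 0, 0, 0, 0]"
  "map (layer_count (1, 0)) [0..<12] = [0, 0, 2, 2, 2, 2, 2, 2, 2, 2, 2, 2]"
  "map (layer_count (- 1, 1)) [0..<12] = [2, 0, 0, 0, 0, 0, 0, 2, 2, 2, 2, 2]"
  "map (layer_count (0, 0)) [0..<12] = [0, 10, 2, 2, 2, 2, 2, 2, 2, 2, 2, 2]"
  "map (layer_count (1, - 1)) [0..<12] = [2, 0, 0, 0, 0, 0, 0, 2, 2, 2, 2, 2]"
  "map (layer_count (- 1, 0)) [0..<12] = [0, 0, 2, 2, 2, 2, 2, 2, 2, 2, 2, 2]"
  "map (layer_count (0, - 1)) [0..<12] = [2, 0, 2, 2, 2, 2, 2, 0, 0, 0, 0, 0]"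
  "map (layer_count (- 2, 0)) [0..<12] = [1, 0, 0, 0, 0, 0, 0, 0, 0, 0, 0, 0]"
  by code_simp+

lemma icosian_real_parts:
  "z \<in> set icosians \<Longrightarrow>
     fst z \<in> {(2, 0), (0, 1), (1, 0), (- 1, 1), (0, 0), (1, - 1), (- 1, 0), (0, - 1), (- 2, 0)}"
proof -
  have "list_all (\<lambda>z. fst z \<in> set [(2, 0), (0, 1), (1, 0), (- 1, 1), (0, 0), (1, - 1), (- 1, 0),
      (0, - 1), (- 2, 0)]) icosians" by code_simp
  then show "z \<in> set icosians \<Longrightarrow> ?thesis" by (simp add: list_all_iff)
qed

lemma cos_layers:
  "cos 0 = golden_val (2, 0) / 2" "cos (pi / 5) = golden_val (0, 1) / 2"
  "cos (pi / 3) = golden_val (1, 0) / 2"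
  "cos (2 * pi / 5) = golden_val (- 1, 1) / 2" "cos (pi / 2) = golden_val (0, 0) / 2"
  "cos (3 * pi / 5) = golden_val (1, - 1) / 2" "cos (2 * pi / 3) = golden_val (- 1, 0) / 2"
  "cos (4 * pi / 5) = golden_val (0, - 1) / 2" "cos pi = golden_val (- 2, 0) / 2"
proof -
  have "pi - 2 * pi / 5 = 3 * pi / 5" "pi - pi / 5 = 4 * pi / 5" "pi - pi / 3 = 2 * pi / 3"
    by simp_all
  then have "cos (3 * pi / 5) = - cos (2 * pi / 5)" "cos (4 * pi / 5) = - cos (pi / 5)"
    "cos (2 * pi / 3) = - cos (pi / 3)"
    by (metis cos_pi_minus)+
  then show "cos (3 * pi / 5) = golden_val (1, - 1) / 2"
    "cos (4 * pi / 5) = golden_val (0, - 1) / 2"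
    "cos (2 * pi / 3) = golden_val (- 1, 0) / 2"
    by (simp_all add: cos_pi_fifth cos_two_pi_fifth cos_60 diff_divide_distrib)
qed (simp_all add: cos_pi_fifth cos_two_pi_fifth cos_60)

lemma rotation_type_spinal_list:
  assumes "n \<in> {1, 2, 3, 4}"
  shows "has_rotation_type (psi (quat_of (q_power n))) Face"
proof -
  obtain c where c: "c *\<^sub>R snd (quat_of ico_q) \<in> class_points Face" using class_point_ico_q by blast
  have "list_all (\<lambda>n. snd (q_power n) \<noteq> ((0, 0), (0, 0), (0, 0)) \<and>
      ico_mult2 (q_power n) ico_q = ico_mult2 ico_q (q_power n)) [1, 2, 3, 4]"
    by code_simp
  then have *: "snd (q_power n) \<noteq> ((0, 0), (0, 0), (0, 0))"
    "ico_mult2 (q_power n) ico_q = ico_mult2 ico_q (q_power n)"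
    using assms by (auto simp del: q_power.simps)
  have "quat_of (q_power n) \<in> S3" using assms by (intro bin_dod_S3 q_power_bin_dod) auto
  then show ?thesis using * by (rule rotation_type_axis[OF _ _ _ c])
qed

text \<open>The representatives of the layers are \<open>q\<^sup>n\<close> for the face rotations and for \<open>\<plusminus> 1\<close>, the
  quaternions \<open>(\<plusminus> 1 + i + j + k) / 2\<close> for the vertex rotations, and \<open>i\<close> for the edge rotations.\<close>

lemma layer_face:
  assumes "n \<in> {1, 2, 3, 4}" "z \<in> set icosians" "fst z = fst (q_power n)"
  shows "has_rotation_type (psi (quat_of z)) T' \<longleftrightarrow> T' = Face"
proof (rule rotation_type_layer[OF _ _ rotation_type_spinal_list[OF assms(1)] assms(2,3)])
  show "layer_conjugate 1 (q_power n)" using assms(1) layer_conjugates by auto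
  show "quat_of (q_power n) \<in> S3" using assms(1) by (intro bin_dod_S3 q_power_bin_dod) auto
qed

lemma layer_identity:
  assumes "n \<in> {0, 5}" "z \<in> set icosians" "fst z = fst (q_power n)"
  shows "has_rotation_type (psi (quat_of z)) T' \<longleftrightarrow> T' = Identity"
proof (rule rotation_type_layer[OF _ _ _ assms(2,3)])
  show "layer_conjugate 1 (q_power n)" using assms(1) layer_conjugates by auto
  show S: "quat_of (q_power n) \<in> S3" using assms(1) by (intro bin_dod_S3 q_power_bin_dod) auto
  have "list_all (\<lambda>n. snd (q_power n) = ((0, 0), (0, 0), (0, 0))) [0, 5]" by code_simp
  then show "has_rotation_type (psi (quat_of (q_power n))) Identity"
    using assms(1) S by (auto simp: psi_eq_id_iff snd_quat_of_eq_0_iff simp del: q_power.simps)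
qed

lemma layer_vertex:
  assumes "r \<in> {ico_r, ((- 1, 0), (1, 0), (1, 0), (1, 0))}" "z \<in> set icosians" "fst z = fst r"
  shows "has_rotation_type (psi (quat_of z)) T' \<longleftrightarrow> T' = Vertex"
proof (rule rotation_type_layer[OF _ _ _ assms(2,3)])
  show "layer_conjugate 5 r" using assms(1) layer_conjugate_ico_r layer_conjugate_ico_neg_r by auto
  have *: "list_all (\<lambda>r. ico_mult2 r (ico_cnj r) = ico_double ((2, 0), (0, 0), (0, 0), (0, 0)) \<and>
      snd r \<noteq> ((0, 0), (0, 0), (0, 0)) \<and> ico_mult2 r ico_r = ico_mult2 ico_r r)
      [ico_r, ((- 1, 0), (1, 0), (1, 0), (1, 0))]" by code_simp
  then show S: "quat_of r \<in> S3" using assms(1) by (intro quat_of_S3) (auto simp: list_all_iff)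
  obtain c where c: "c *\<^sub>R snd (quat_of ico_r) \<in> class_points Vertex" using class_point_ico_r
    by blast
  show "has_rotation_type (psi (quat_of r)) Vertex"
    using assms(1) * by (intro rotation_type_axis[OF S _ _ c]) (auto simp: list_all_iff)
qed

lemma layer_edge:
  assumes "z \<in> set icosians" "fst z = fst ico_i"
  shows "has_rotation_type (psi (quat_of z)) T' \<longleftrightarrow> T' = Edge"
proof (rule rotation_type_layer[OF layer_conjugate_ico_i _ _ assms])
  show S: "quat_of ico_i \<in> S3" by (rule quat_of_S3) code_simp
  obtain c where c: "c *\<^sub>R snd (quat_of ico_i) \<in> class_points Edge" using class_point_ico_i by blast
  show "has_rotation_type (psi (quat_of ico_i)) Edge"
    by (rule rotation_type_axis[OF S _ _ c]) (simp_all add: ico_i_def)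
qed

lemma fst_representatives:
  "fst (q_power 0) = (2, 0)" "fst (q_power 1) = (0, 1)" "fst (q_power 2) = (- 1, 1)"
  "fst (q_power 3) = (1, - 1)"
  "fst (q_power 4) = (0, - 1)" "fst (q_power 5) = (- 2, 0)" "fst ico_r = (1, 0)"
  "fst ico_i = (0, 0)"
  by code_simp+

theorem proposition6p3:
  shows "(\<forall>p \<in> bin_dod. dist_S qone p \<in>
            {0, pi/5, pi/3, 2*pi/5, pi/2, 3*pi/5, 2*pi/3, 4*pi/5, pi}) \<and>
         card outer_rings = 5 \<and>
         layer_row 0        Identity  1 1  0  0 0 0 \<and>
         layer_row (pi/5)   Face     12 2  0 10 2 0 \<and>
         layer_row (pi/3)   Vertex   20 0  0 20 2 2 \<and>
         layer_row (2*pi/5) Face     12 2  0 10 0 2 \<and>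
         layer_row (pi/2)   Edge     30 0 10 20 2 2 \<and>
         layer_row (3*pi/5) Face     12 2  0 10 0 2 \<and>
         layer_row (2*pi/3) Vertex   20 0  0 20 2 2 \<and>
         layer_row (4*pi/5) Face     12 2  0 10 2 0 \<and>
         layer_row pi       Identity  1 1  0  0 0 0"
proof (intro conjI)
  show "\<forall>p \<in> bin_dod. dist_S qone p \<in>
      {0, pi/5, pi/3, 2*pi/5, pi/2, 3*pi/5, 2*pi/3, 4*pi/5, pi}"
  proof
    fix p assume p: "p \<in> bin_dod"
    then obtain z where z: "z \<in> set icosians" "p = quat_of z" unfolding bin_dod_eq by blast
    have "dist_S qone p = d" if "golden_val (fst z) / 2 = cos d" "0 \<le> d" "d \<le> pi" for d
      using dist_S_qone_eq_iff[OF bin_dod_S3[OF p] that(2,3)] that(1) by (simp add: z(2) fst_quat_of)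
    note * = this[OF _ _ _]
    show "dist_S qone p \<in> {0, pi/5, pi/3, 2*pi/5, pi/2, 3*pi/5, 2*pi/3, 4*pi/5, pi}"
      using icosian_real_parts[OF z(1)] *[of 0] *[of "pi / 5"] *[of "pi / 3"] *[of "2 * pi / 5"]
        *[of "pi / 2"] *[of "3 * pi / 5"] *[of "2 * pi / 3"] *[of "4 * pi / 5"] *[of pi]
      unfolding cos_layers by (auto simp del: golden_val.simps)
  qed
  show "card outer_rings = 5" by (rule card_outer_rings)
  show "layer_row 0 Identity 1 1 0 0 0 0"
    using layer_row_counts[OF _ _ cos_layers(1) layer_identity[of 0] layer_counts(1)]
    by (simp add: fst_representatives del: q_power.simps)
  show "layer_row (pi / 5) Face 12 2 0 10 2 0"
    using layer_row_counts[OF _ _ cos_layers(2) layer_face[of 1] layer_counts(2)]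
    by (simp add: fst_representatives del: q_power.simps One_nat_def)
  show "layer_row (pi / 3) Vertex 20 0 0 20 2 2"
    using layer_row_counts[OF _ _ cos_layers(3) layer_vertex[of ico_r] layer_counts(3)]
    by (simp add: fst_representatives)
  show "layer_row (2 * pi / 5) Face 12 2 0 10 0 2"
    using layer_row_counts[OF _ _ cos_layers(4) layer_face[of 2] layer_counts(4)]
    by (simp add: fst_representatives del: q_power.simps)
  show "layer_row (pi / 2) Edge 30 0 10 20 2 2"
    using layer_row_counts[OF _ _ cos_layers(5) layer_edge layer_counts(5)]
    by (simp add: fst_representatives)
  show "layer_row (3 * pi / 5) Face 12 2 0 10 0 2"
    using layer_row_counts[OF _ _ cos_layers(6) layer_face[of 3] layer_counts(6)]
    by (simp add: fst_representatives del: q_power.simps)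
  show "layer_row (2 * pi / 3) Vertex 20 0 0 20 2 2"
    using layer_row_counts[OF _ _ cos_layers(7) layer_vertex[of "((- 1, 0), (1, 0), (1, 0), (1, 0))"]
        layer_counts(7)]
    by simp
  show "layer_row (4 * pi / 5) Face 12 2 0 10 2 0"
    using layer_row_counts[OF _ _ cos_layers(8) layer_face[of 4] layer_counts(8)]
    by (simp add: fst_representatives del: q_power.simps)
  show "layer_row pi Identity 1 1 0 0 0 0"
    using layer_row_counts[OF _ _ cos_layers(9) layer_identity[of 5] layer_counts(9)]
    by (simp add: fst_representatives del: q_power.simps)
qed

end
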